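(* Let $\mathcal{J}$ be an ideal on $\omega$. Then $\mathcal{J}$ is representable in some Polish Abelian group if and only if $\mathcal{J}$ is an analytic P-ideal.
   Context: An ideal on $\omega$ is a family $\mathcal{J}\subseteq\mathcal{P}(\omega)$ closed under subsets and finite unions, which is proper ($\omega\notin\mathcal{J}$) and contains all finite subsets of $\omega$. It is analytic if it is an analytic subset of $\mathcal{P}(\omega)\cong 2^\omega$ (product topology). It is a P-ideal if for every countable $\mathcal{C}\subseteq\mathcal{J}$ there is $A\in\mathcal{J}$ with $C\setminus A$ finite for all $C\in\mathcal{C}$. For a Hausdorff topological Abelian group $G$ and $h\colon\omega\to G$, for $A\subseteq\omega$ we say $\sum_{n\in A}h(n)$ converges (unconditionally) to $a\in G$ if the net $\big(\sum_{n\in F}h(n)\big)_{F\in[A]^{<\omega}}$, directed by inclusion, converges to $a$. If $\sum_{n\in\omega}h(n)$ does not exist, $\mathcal{I}^G_h$ denotes the ideal generated by the family of $A\subseteq\omega$ such that $A$ is finite or $\sum_{n\in A}h(n)$ converges in $G$ (for complete $G$ this family is itself an ideal). An ideal $\mathcal{J}$ is representable in $G$ if $\mathcal{J}=\mathcal{I}^G_h$ for some $h\colon\omega\to G$ such that $\sum_{n\in\omega}h(n)$ does not exist. *)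

theory Defs
  imports "HOL-Analysis.Analysis" "HOL-Algebra.FiniteProduct"
begin

definition ideal_on_omega :: "nat set set \<Rightarrow> bool" where
  "ideal_on_omega J \<longleftrightarrow>
     (\<forall>A\<in>J. \<forall>B. B \<subseteq> A \<longrightarrow> B \<in> J) \<and>
     (\<forall>A\<in>J. \<forall>B\<in>J. A \<union> B \<in> J) \<and>
     UNIV \<notin> J \<and>
     (\<forall>A. finite A \<longrightarrow> A \<in> J)"

definition P_ideal :: "nat set set \<Rightarrow> bool" where
  "P_ideal J \<longleftrightarrow> (\<forall>\<C>. countable \<C> \<and> \<C> \<subseteq> J \<longrightarrow> (\<exists>A\<in>J. \<forall>C\<in>\<C>. finite (C - A)))"

definition polish_topology :: "'a topology \<Rightarrow> bool" where
  "polish_topology X \<longleftrightarrow> completely_metrizable_space X \<and> separable_space X"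

text \<open>
  An analytic set is a continuous image of a Polish space. A Polish space has at most
  continuum many points, so it is homeomorphic to one whose points are elements of
  \<^typ>\<open>nat \<Rightarrow> nat\<close>; quantifying over topologies on subsets of this type loses nothing.
\<close>

definition analytic_in :: "'a topology \<Rightarrow> 'a set \<Rightarrow> bool" where
  "analytic_in X S \<longleftrightarrow>
     (\<exists>(Y :: (nat \<Rightarrow> nat) topology) f.
        polish_topology Y \<and> continuous_map Y X f \<and> f ` topspace Y = S)"

definition cantor_space :: "(nat \<Rightarrow> bool) topology" where
  "cantor_space = product_topology (\<lambda>_. discrete_topology UNIV) UNIV"

text \<open>A family of subsets is regarded as a subset of the Cantor space via characteristic functions.\<close>

definition analytic_family :: "nat set set \<Rightarrow> bool" where
  "analytic_family J \<longleftrightarrow> analytic_in cantor_space ((\<lambda>A n. n \<in> A) ` J)"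

text \<open>Groups are written multiplicatively, so \<^const>\<open>finprod\<close> plays the role of a finite sum.\<close>

locale topological_abelian_group = comm_group G for G (structure) +
  fixes T :: "'a topology"
  assumes topspace_eq: "topspace T = carrier G"
    and Hausdorff: "Hausdorff_space T"
    and continuous_mult: "continuous_map (prod_topology T T) T (\<lambda>(x, y). x \<otimes> y)"
    and continuous_inv: "continuous_map T T (\<lambda>x. inv x)"

locale polish_abelian_group = topological_abelian_group +
  assumes polish: "polish_topology T"

definition sum_converges_to ::
  "('a, 'b) monoid_scheme \<Rightarrow> 'a topology \<Rightarrow> (nat \<Rightarrow> 'a) \<Rightarrow> nat set \<Rightarrow> 'a \<Rightarrow> bool" where
  "sum_converges_to G T h A a \<longleftrightarrow> limitin T (\<lambda>F. finprod G h F) a (finite_subsets_at_top A)"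

definition sum_converges ::
  "('a, 'b) monoid_scheme \<Rightarrow> 'a topology \<Rightarrow> (nat \<Rightarrow> 'a) \<Rightarrow> nat set \<Rightarrow> bool" where
  "sum_converges G T h A \<longleftrightarrow> (\<exists>a\<in>carrier G. sum_converges_to G T h A a)"

text \<open>
  The generated ideal is the intersection of all ideals containing the generators. If there is
  no (proper) such ideal, the hull is the whole power set, which is not an ideal on \<open>\<omega>\<close>.
\<close>

definition summable_ideal ::
  "('a, 'b) monoid_scheme \<Rightarrow> 'a topology \<Rightarrow> (nat \<Rightarrow> 'a) \<Rightarrow> nat set set" where
  "summable_ideal G T h = ideal_on_omega hull {A. finite A \<or> sum_converges G T h A}"

definition representable_in ::
  "nat set set \<Rightarrow> ('a, 'b) monoid_scheme \<Rightarrow> 'a topology \<Rightarrow> bool" where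
  "representable_in J G T \<longleftrightarrow>
     (\<exists>h. h \<in> UNIV \<rightarrow> carrier G \<and> \<not> sum_converges G T h UNIV \<and> J = summable_ideal G T h)"

end

theory Submission
  imports Defs
begin

text \<open>
  If \<open>J\<close> is represented by \<open>h\<close> in a Polish Abelian group, then the group is complete, so a sum converges
  iff its tails become small. This makes \<open>J\<close> an $F_{\sigma\delta}$ set, and gluing tails of countably many
  members, the \<open>i\<close>-th one \<open>V i\<close>-small, gives a pseudo-union.

  Conversely, let \<open>J\<close> be the image of a Polish space under a continuous \<open>g\<close>. After removing a relatively open
  part, every nonempty open \<open>U\<close> has an image cofinal in \<open>J\<close> modulo finite sets, so the closed
  hereditary set \<open>K U\<close> generated by the image contains a tail of each member of \<open>J\<close>. A set having a tail in every \<open>K U\<close>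
  belongs to \<open>J\<close> by an interleaving construction, and by the Baire category theorem each closed hereditary set absorbing the
  tails of \<open>J\<close> contains all pairwise unions from a smaller set of the same kind. This yields sets \<open>C n\<close> which
  behave like the balls of radius $2^{-n}$ of a lower semicontinuous submeasure whose exhaustive ideal
  is \<open>J\<close> (Solecki's theorem). A Birkhoff-Kakutani construction turns them into a complete separable invariant
  metric on the group \<open>J\<close> with symmetric difference, and \<open>n \<mapsto> {n}\<close> represents \<open>J\<close> in this group.
\<close>

(* HOL-Algebra's notation would make the topological closure_of ambiguous. *)
no_notation eq_closure_of (\<open>closure'_of\<index>\<close>)

section \<open>Polish Abelian groups represent only analytic P-ideals\<close>

text \<open>Choosing a witness \<open>N\<close> for each \<open>k\<close> turns membership in
  \<open>J\<close> into a closed condition on the pair of set and witness sequence, since each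
  instance of \<open>P\<close> involves finitely many coordinates. So \<open>J\<close> is a
  continuous image of a closed subset of the Baire space.\<close>

lemma analytic_familyI:
  fixes P :: "nat \<Rightarrow> nat \<Rightarrow> nat set \<Rightarrow> bool"
  assumes J: "J = {A. \<forall>k. \<exists>N. \<forall>F. finite F \<and> F \<subseteq> A \<longrightarrow> P k N F}"
  shows "analytic_family J"
proof -
  txt \<open>Even coordinates code the set, odd ones the witnesses \<open>N\<close>.\<close>
  define X where "X = product_topology (\<lambda>_::nat. discrete_topology (UNIV :: nat set)) UNIV"
  define A where "A f = {n. f (2 * n) = (1::nat)}" for f :: "nat \<Rightarrow> nat"
  define Z where "Z k F = {f. F \<subseteq> A f \<longrightarrow> P k (f (2 * k + 1)) F}" for k F
  define S where "S = (\<Inter>k. \<Inter>F\<in>{F. finite F}. Z k F)"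
  have topX [simp]: "topspace X = UNIV" by (simp add: X_def)
  have coord: "openin X {f. Q (f i)}" for Q :: "nat \<Rightarrow> bool" and i
  proof -
    have "continuous_map X (discrete_topology UNIV) (\<lambda>f. f i)"
      unfolding X_def by (rule continuous_map_product_projection) simp
    then have "openin X {f \<in> topspace X. f i \<in> {a. Q a}}"
      by (rule openin_continuous_map_preimage) simp
    then show ?thesis by simp
  qed
  have sub: "openin X {f. F \<subseteq> A f}" if "finite F" for F
    using that
  proof (induction F rule: finite_induct)
    case empty
    then show ?case using openin_topspace[of X] by simp
  next
    case (insert a F)
    have "{f. insert a F \<subseteq> A f} = {f. f (2 * a) = 1} \<inter> {f. F \<subseteq> A f}" by (auto simp: A_def)
    then show ?case using insert.IH coord[of "\<lambda>v. v = 1" "2 * a"] by auto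
  qed
  have "closedin X (Z k F)" if "finite F" for k F
  proof -
    have "openin X ({f. F \<subseteq> A f} \<inter> {f. \<not> P k (f (2 * k + 1)) F})"
      using sub[OF that] coord[of "\<lambda>v. \<not> P k v F" "2 * k + 1"] by (rule openin_Int)
    moreover have "UNIV - Z k F = {f. F \<subseteq> A f} \<inter> {f. \<not> P k (f (2 * k + 1)) F}"
      by (auto simp: Z_def)
    ultimately show ?thesis by (simp add: closedin_def)
  qed
  then have clS: "closedin X S"
    unfolding S_def by (intro closedin_INT) auto
  have "completely_metrizable_space X"
    unfolding X_def by (simp add: completely_metrizable_space_product_topology completely_metrizable_space_discrete_topology)
  then have cm: "completely_metrizable_space (subtopology X S)"
    using clS by (rule completely_metrizable_space_closedin)
  \<comment> \<open>Identifying \<open>X\<close> with the type class topology makes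
    \<open>ex_countable_basis\<close> applicable.\<close>
  have "discrete_topology (UNIV :: nat set) = euclidean"
    unfolding discrete_topology_unique by (simp add: open_discrete flip: open_openin)
  then have "X = euclidean" unfolding X_def by (simp add: euclidean_product_topology)
  moreover have "second_countable (euclidean :: (nat \<Rightarrow> nat) topology)"
  proof -
    obtain B :: "(nat \<Rightarrow> nat) set set" where B: "countable B" "topological_basis B"
      using ex_countable_basis by blast
    have "\<exists>V\<in>B. y \<in> V \<and> V \<subseteq> U" if "open U" "y \<in> U" for U y
      using topological_basisE[OF B(2) that] by metis
    then show ?thesis
      unfolding second_countable_def open_openin[symmetric]
      using B(1) topological_basis_open[OF B(2)] by blast
  qed
  ultimately have "separable_space (subtopology X S)"
    by (simp add: second_countable_subtopology second_countable_imp_separable_space)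
  then have pol: "polish_topology (subtopology X S)" using cm by (simp add: polish_topology_def)
  have cont: "continuous_map (subtopology X S) cantor_space (\<lambda>f n. n \<in> A f)"
    unfolding cantor_space_def continuous_map_componentwise_UNIV
  proof
    fix n
    have "continuous_map X (discrete_topology UNIV) (\<lambda>f. n \<in> A f)"
      unfolding continuous_map_def using coord[of "\<lambda>v. (v = 1) \<in> U" "2 * n" for U] by (simp add: A_def)
    then show "continuous_map (subtopology X S) (discrete_topology UNIV) (\<lambda>f. n \<in> A f)"
      by (rule continuous_map_from_subtopology)
  qed
  have im: "A ` S = J"
  proof (intro subset_antisym subsetI)
    fix B assume "B \<in> A ` S"
    then obtain f where "f \<in> S" "B = A f" by blast
    then show "B \<in> J" unfolding J S_def Z_def by auto
  next
    fix B assume "B \<in> J"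
    then obtain N where N: "\<And>k F. finite F \<Longrightarrow> F \<subseteq> B \<Longrightarrow> P k (N k) F"
      unfolding J mem_Collect_eq by metis
    define f where "f i = (if even i then (if i div 2 \<in> B then 1 else 0) else N (i div 2))" for i
    have "A f = B" by (auto simp: A_def f_def)
    moreover have "f \<in> S" using N \<open>A f = B\<close> by (auto simp: S_def Z_def f_def)
    ultimately show "B \<in> A ` S" by blast
  qed
  have "(\<lambda>f n. n \<in> A f) ` topspace (subtopology X S) = (\<lambda>A n. n \<in> A) ` J"
    unfolding im[symmetric] by (simp add: image_image)
  then show ?thesis
    unfolding analytic_family_def analytic_in_def using pol cont by blast
qed

section \<open>Neighbourhoods and the Cauchy criterion in topological Abelian groups\<close>

context topological_abelian_group
begin

lemma mult_nbhd:
  assumes "openin T W" "a \<in> carrier G" "b \<in> carrier G" "a \<otimes> b \<in> W"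
  shows "\<exists>U V. openin T U \<and> openin T V \<and> a \<in> U \<and> b \<in> V \<and> (\<forall>x\<in>U. \<forall>y\<in>V. x \<otimes> y \<in> W)"
proof -
  let ?S = "{p \<in> topspace (prod_topology T T). (case p of (x, y) \<Rightarrow> x \<otimes> y) \<in> W}"
  have S: "openin (prod_topology T T) ?S"
    using continuous_mult assms(1) by (rule openin_continuous_map_preimage)
  have ab: "(a, b) \<in> ?S" using assms by (simp add: topspace_eq)
  obtain U V where UV: "openin T U" "openin T V" "a \<in> U" "b \<in> V" "U \<times> V \<subseteq> ?S"
    using S[unfolded openin_prod_topology_alt, rule_format, OF ab] by (elim exE conjE)
  have "\<forall>x\<in>U. \<forall>y\<in>V. x \<otimes> y \<in> W" using UV(5) by auto
  then show ?thesis using UV(1-4) by blast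
qed

lemma one_nbhd:
  assumes "openin T W" "\<one> \<in> W"
  shows "\<exists>V. openin T V \<and> \<one> \<in> V \<and> (\<forall>x\<in>V. \<forall>y\<in>V. x \<otimes> y \<in> W)"
proof -
  have "\<one> \<otimes> \<one> \<in> W" using assms(2) by simp
  then obtain U V where "openin T U" "openin T V" "\<one> \<in> U" "\<one> \<in> V" "\<forall>x\<in>U. \<forall>y\<in>V. x \<otimes> y \<in> W"
    using mult_nbhd[OF assms(1) one_closed one_closed] by blast
  then show ?thesis by (intro exI[of _ "U \<inter> V"]) auto
qed

lemma divide_nbhd:
  assumes "openin T W" "\<one> \<in> W" "a \<in> carrier G"
  shows "\<exists>U. openin T U \<and> a \<in> U \<and> (\<forall>x\<in>U. \<forall>y\<in>U. x \<otimes> inv y \<in> W)"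
proof -
  have "a \<otimes> inv a \<in> W" using assms(2,3) by simp
  then obtain U V where UV: "openin T U" "openin T V" "a \<in> U" "inv a \<in> V" "\<forall>x\<in>U. \<forall>y\<in>V. x \<otimes> y \<in> W"
    using mult_nbhd[OF assms(1,3) inv_closed[OF assms(3)]] by blast
  have "openin T {x \<in> topspace T. inv x \<in> V}"
    using continuous_inv UV(2) by (rule openin_continuous_map_preimage)
  then show ?thesis
    using UV assms(3) by (intro exI[of _ "U \<inter> {x \<in> topspace T. inv x \<in> V}"]) (auto simp: topspace_eq)
qed

lemma limitin_mult:
  assumes "limitin T f a F" "b \<in> carrier G"
  shows "limitin T (\<lambda>x. f x \<otimes> b) (a \<otimes> b) F"
  unfolding limitin_def
proof (intro conjI allI impI)
  have a: "a \<in> carrier G" using assms(1) limitin_topspace topspace_eq by metis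
  then show "a \<otimes> b \<in> topspace T" using assms(2) topspace_eq by simp
  fix W assume "openin T W \<and> a \<otimes> b \<in> W"
  then obtain U V where UV: "openin T U" "openin T V" "a \<in> U" "b \<in> V" "\<And>x y. x \<in> U \<Longrightarrow> y \<in> V \<Longrightarrow> x \<otimes> y \<in> W"
    using mult_nbhd[of W a b] a assms(2) by blast
  have "\<forall>\<^sub>F x in F. f x \<in> U" using assms(1) UV(1,3) by (simp add: limitin_def)
  then show "\<forall>\<^sub>F x in F. f x \<otimes> b \<in> W" by eventually_elim (use UV in blast)
qed

text \<open>The Cauchy criterion for unconditional sums. The tail is cut off inside the product,
  with \<open>F\<close> ranging over all finite subsets of \<open>A\<close>, to match the form
  required by \<open>analytic_familyI\<close>.\<close>

definition cauchy_tails :: "(nat \<Rightarrow> 'a) \<Rightarrow> nat set \<Rightarrow> bool" where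
  "cauchy_tails h A \<longleftrightarrow> (\<forall>V. openin T V \<and> \<one> \<in> V \<longrightarrow>
     (\<exists>N. \<forall>F. finite F \<and> F \<subseteq> A \<longrightarrow> finprod G h (F - {..<N}) \<in> V))"

lemma cauchy_tails_D:
  assumes "cauchy_tails h A" "openin T V" "\<one> \<in> V"
  shows "\<exists>N. \<forall>F. finite F \<and> F \<subseteq> A \<longrightarrow> finprod G h (F - {..<N}) \<in> V"
  using assms(1)[unfolded cauchy_tails_def, rule_format, of V] assms(2,3) by simp

lemma sum_converges_imp_cauchy_tails:
  assumes h: "h \<in> UNIV \<rightarrow> carrier G" and "sum_converges G T h A"
  shows "cauchy_tails h A"
  unfolding cauchy_tails_def
proof (intro allI impI; elim conjE)
  fix V assume V: "openin T V" "\<one> \<in> V"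
  obtain a where a: "a \<in> carrier G" "limitin T (finprod G h) a (finite_subsets_at_top A)"
    using assms(2) by (auto simp: sum_converges_def sum_converges_to_def)
  obtain U where U: "openin T U" "a \<in> U" "\<And>x y. x \<in> U \<Longrightarrow> y \<in> U \<Longrightarrow> x \<otimes> inv y \<in> V"
    using divide_nbhd[OF V a(1)] by blast
  have "\<forall>\<^sub>F F in finite_subsets_at_top A. finprod G h F \<in> U"
    using a(2) U by (simp add: limitin_def)
  then obtain X where X: "finite X" "X \<subseteq> A" "\<And>F. finite F \<Longrightarrow> X \<subseteq> F \<Longrightarrow> F \<subseteq> A \<Longrightarrow> finprod G h F \<in> U"
    unfolding eventually_finite_subsets_at_top by meson
  obtain N where N: "X \<subseteq> {..<N}" using X(1) finite_nat_iff_bounded by blast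
  have "finprod G h (F - {..<N}) \<in> V" if F: "finite F" "F \<subseteq> A" for F
  proof -
    \<comment> \<open>The product over \<open>?E\<close> is the quotient of the products over
      \<open>?E \<union> X\<close> and \<open>X\<close>, two finite sets above \<open>X\<close>, so
      both products lie in \<open>U\<close>.\<close>
    let ?E = "F - {..<N}"
    have c: "finprod G h B \<in> carrier G" for B using h by (intro finprod_closed) auto
    have "finprod G h (?E \<union> X) = finprod G h ?E \<otimes> finprod G h X"
      by (rule finprod_Un_disjoint) (use F X N h in auto)
    then have "finprod G h ?E = finprod G h (?E \<union> X) \<otimes> inv finprod G h X"
      using c by (simp add: m_assoc)
    also have "\<dots> \<in> V" using X F by (intro U X(3)) auto
    finally show ?thesis .
  qed
  then show "\<exists>N. \<forall>F. finite F \<and> F \<subseteq> A \<longrightarrow> finprod G h (F - {..<N}) \<in> V" by blast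
qed

end

section \<open>Completeness of Polish Abelian groups and convergence of sums\<close>

context polish_abelian_group
begin

text \<open>
  The metric need not be invariant. By the Baire category theorem there is \<open>g\<close> such that the
  translates of the \<open>x n\<close> by the inverse of \<open>g\<close> are Cauchy for the metric: for each radius, the
  \<open>g\<close> whose translates eventually stay in a ball of that radius form a dense open set.
\<close>

lemma group_cauchy_imp_limit:
  assumes x: "\<And>n. x n \<in> carrier G"
    and cauchy: "\<And>V. openin T V \<Longrightarrow> \<one> \<in> V \<Longrightarrow> \<exists>N. \<forall>m\<ge>N. \<forall>n\<ge>m. x n \<otimes> inv x m \<in> V"
  shows "\<exists>a. limitin T x a sequentially"
proof -
  obtain M d where M: "Metric_space M d" "Metric_space.mcomplete M d" "T = Metric_space.mtopology M d"
    using polish unfolding polish_topology_def completely_metrizable_space_def by blast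
  interpret Metric_space M d by fact
  have MG: "M = carrier G" using topspace_eq M(3) by simp
  define near where "near k B \<longleftrightarrow> openin T B \<and>
      (\<exists>p N. \<forall>n\<ge>N. \<forall>g\<in>B. x n \<otimes> inv g \<in> mball p (inverse (Suc k)))" for k B
  define D where "D k = \<Union>{B. near k B}" for k
  have "openin T (D k)" for k unfolding D_def by (rule openin_Union) (simp add: near_def)
  moreover have "T closure_of D k = carrier G" for k
  proof (intro subset_antisym)
    show "T closure_of D k \<subseteq> carrier G" using closure_of_subset_topspace[of T] topspace_eq by simp
    show "carrier G \<subseteq> T closure_of D k"
    proof
      fix g0 assume g0: "g0 \<in> carrier G"
      have "\<exists>g\<in>D k. g \<in> W" if W: "openin T W" "g0 \<in> W" for W
      proof -
        have "\<one> \<otimes> g0 \<in> W" using W(2) g0 by simp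
        then obtain U V where
          UV: "openin T U" "openin T V" "\<one> \<in> U" "\<And>u v. u \<in> U \<Longrightarrow> v \<in> V \<Longrightarrow> u \<otimes> v \<in> W" "g0 \<in> V"
          using mult_nbhd[OF W(1) one_closed g0] by blast
        obtain N where N: "\<And>m n. N \<le> m \<Longrightarrow> m \<le> n \<Longrightarrow> x n \<otimes> inv x m \<in> U"
          using cauchy[OF UV(1,3)] by blast
        \<comment> \<open>Solving \<open>x m \<otimes> inv g = p\<close> for \<open>g\<close> with
          \<open>m\<close> large gives a \<open>g\<close> that differs from \<open>g0\<close> by the
          small factor \<open>x m \<otimes> inv x N\<close>, while
          \<open>x n \<otimes> inv g\<close> differs from \<open>p\<close> by the small factor
          \<open>x n \<otimes> inv x m\<close>.\<close>
        define p where "p = x N \<otimes> inv g0"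
        have p: "p \<in> carrier G" unfolding p_def using x g0 by simp
        define O' where "O' = mball p (inverse (Suc k))"
        have O': "openin T O'" "p \<in> O'" unfolding O'_def M(3) using p[folded MG] by simp_all
        have "\<one> \<otimes> p \<in> O'" using O' p by simp
        then obtain P Q where PQ: "openin T P" "openin T Q" "\<one> \<in> P" "p \<in> Q" "\<And>u v. u \<in> P \<Longrightarrow> v \<in> Q \<Longrightarrow> u \<otimes> v \<in> O'"
          using mult_nbhd[OF O'(1) one_closed p] by blast
        have "p \<otimes> \<one> \<in> Q" using PQ(4) p by simp
        then obtain R S where RS: "openin T R" "openin T S" "p \<in> R" "\<one> \<in> S" "\<And>u v. u \<in> R \<Longrightarrow> v \<in> S \<Longrightarrow> u \<otimes> v \<in> Q"
          using mult_nbhd[OF PQ(2) p one_closed] by blast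
        obtain L where L: "\<And>m n. L \<le> m \<Longrightarrow> m \<le> n \<Longrightarrow> x n \<otimes> inv x m \<in> P"
          using cauchy[OF PQ(1,3)] by blast
        define m where "m = max N L"
        define g where "g = x m \<otimes> inv p"
        have g: "g \<in> carrier G" unfolding g_def using x p by simp
        have "g = (x m \<otimes> inv x N) \<otimes> g0"
          unfolding g_def p_def using x g0 by (simp add: inv_mult_group m_ac)
        also have "\<dots> \<in> W" using N[of N m] UV(4,5) by (simp add: m_def)
        finally have gW: "g \<in> W" .
        obtain B where B: "openin T B" "g \<in> B" "\<And>u v. u \<in> B \<Longrightarrow> v \<in> B \<Longrightarrow> u \<otimes> inv v \<in> S"
          using divide_nbhd[OF RS(2,4) g] by blast
        have "x n \<otimes> inv g' \<in> O'" if n: "m \<le> n" and g': "g' \<in> B" for n g'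
        proof -
          have g'c: "g' \<in> carrier G" using g' B(1) openin_subset topspace_eq by blast
          have "(x n \<otimes> inv x m) \<otimes> (p \<otimes> (g \<otimes> inv g'))
              = (x n \<otimes> inv g') \<otimes> ((x m \<otimes> inv x m) \<otimes> (p \<otimes> inv p))"
            unfolding g_def by (simp only: m_ac m_closed inv_closed x p g'c)
          also have "\<dots> = x n \<otimes> inv g'" using x p g'c by simp
          finally have "x n \<otimes> inv g' = (x n \<otimes> inv x m) \<otimes> (p \<otimes> (g \<otimes> inv g'))" by simp
          also have "\<dots> \<in> O'"
            by (intro PQ(5) RS(5) L B(3) g' B(2) RS(3) n) (simp add: m_def)
          finally show ?thesis .
        qed
        then have "near k B" unfolding near_def O'_def using B(1) by blast
        then show ?thesis using B(2) gW unfolding D_def by blast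
      qed
      then show "g0 \<in> T closure_of D k" unfolding in_closure_of using g0 topspace_eq by blast
    qed
  qed
  ultimately have "T closure_of \<Inter>(range D) = carrier G"
    using metric_Baire_category[of "range D"] M(2) unfolding M(3) MG by auto
  then have "\<Inter>(range D) \<noteq> {}" using one_closed by force
  then obtain g where g: "\<And>k. g \<in> D k" by auto
  have gc: "g \<in> carrier G"
    using g[of 0] openin_subset topspace_eq unfolding D_def near_def by blast
  let ?y = "\<lambda>n. x n \<otimes> inv g"
  have "MCauchy ?y"
    unfolding MCauchy_def
  proof (intro conjI allI impI)
    show "range ?y \<subseteq> M" using x gc MG by auto
    fix e :: real assume "e > 0"
    then obtain k where k: "inverse (real (Suc k)) < e / 2" using reals_Archimedean half_gt_zero by blast
    obtain p N where N: "\<And>n. N \<le> n \<Longrightarrow> ?y n \<in> mball p (inverse (Suc k))"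
      using g[of k] unfolding D_def near_def by blast
    have "d (?y n) (?y n') < e" if "N \<le> n" "N \<le> n'" for n n'
    proof -
      have *: "?y n \<in> mball p (inverse (Suc k))" "?y n' \<in> mball p (inverse (Suc k))" using N that by blast+
      have "d (?y n) (?y n') \<le> d (?y n) p + d p (?y n')" using * by (intro triangle) auto
      also have "\<dots> < e" using * k by (simp add: commute)
      finally show ?thesis .
    qed
    then show "\<exists>N. \<forall>n n'. N \<le> n \<longrightarrow> N \<le> n' \<longrightarrow> d (?y n) (?y n') < e" by blast
  qed
  then obtain y where "limitin T ?y y sequentially" using M(2,3) unfolding mcomplete_def by blast
  from limitin_mult[OF this gc] have "limitin T (\<lambda>n. ?y n \<otimes> g) (y \<otimes> g) sequentially" .
  moreover have "?y n \<otimes> g = x n" for n using x gc by (simp add: m_assoc)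
  ultimately show ?thesis by auto
qed

text \<open>The products over initial segments of \<open>A\<close> form a Cauchy sequence of the
  group, so they have a limit. A finite subset of \<open>A\<close> above a long initial segment
  changes its product only by a small tail, so the whole net has the same limit.\<close>

lemma cauchy_tails_imp_sum_converges:
  assumes h: "h \<in> UNIV \<rightarrow> carrier G" and A: "cauchy_tails h A"
  shows "sum_converges G T h A"
proof -
  have c: "finprod G h B \<in> carrier G" for B using h by (intro finprod_closed) auto
  define x where "x n = finprod G h (A \<inter> {..<n})" for n
  have sum_split: "finprod G h F = finprod G h (F - {..<m}) \<otimes> x m"
    if F: "finite F" "F \<subseteq> A" "A \<inter> {..<m} \<subseteq> F" for F m
  proof -
    have "F = (F - {..<m}) \<union> (A \<inter> {..<m})" using F by blast
    then have "finprod G h F = finprod G h ((F - {..<m}) \<union> (A \<inter> {..<m}))" by simp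
    also have "\<dots> = finprod G h (F - {..<m}) \<otimes> x m"
      unfolding x_def by (rule finprod_Un_disjoint) (use F h in auto)
    finally show ?thesis .
  qed
  have "\<exists>a. limitin T x a sequentially"
  proof (rule group_cauchy_imp_limit)
    fix V assume "openin T V" "\<one> \<in> V"
    then obtain N where N: "\<And>F. finite F \<Longrightarrow> F \<subseteq> A \<Longrightarrow> finprod G h (F - {..<N}) \<in> V"
      using cauchy_tails_D[OF A] by meson
    have "x n \<otimes> inv x m \<in> V" if mn: "N \<le> m" "m \<le> n" for m n
    proof -
      let ?F = "A \<inter> {..<n} - {..<m}"
      have "x n = finprod G h ?F \<otimes> x m"
        unfolding x_def[of n] by (rule sum_split) (use mn in auto)
      then have "x n \<otimes> inv x m = finprod G h ?F"
        using c by (simp add: m_assoc x_def)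
      also have "?F = ?F - {..<N}" using mn by auto
      also have "finprod G h \<dots> \<in> V" by (rule N) auto
      finally show ?thesis .
    qed
    then show "\<exists>N. \<forall>m\<ge>N. \<forall>n\<ge>m. x n \<otimes> inv x m \<in> V" by blast
  qed (simp add: x_def c)
  then obtain a where a: "limitin T x a sequentially" by blast
  have ac: "a \<in> carrier G" using a limitin_topspace topspace_eq by metis
  have "limitin T (finprod G h) a (finite_subsets_at_top A)"
    unfolding limitin_def
  proof (intro conjI allI impI)
    show "a \<in> topspace T" using ac topspace_eq by simp
    fix W assume W: "openin T W \<and> a \<in> W"
    then have W': "openin T W" "\<one> \<otimes> a \<in> W" using ac by simp_all
    obtain V U where UV: "openin T V" "openin T U" "\<one> \<in> V" "a \<in> U" "\<And>u v. u \<in> V \<Longrightarrow> v \<in> U \<Longrightarrow> u \<otimes> v \<in> W"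
      using mult_nbhd[OF W'(1) one_closed ac W'(2)] by blast
    obtain N where N: "\<And>F. finite F \<Longrightarrow> F \<subseteq> A \<Longrightarrow> finprod G h (F - {..<N}) \<in> V"
      using cauchy_tails_D[OF A UV(1,3)] by meson
    obtain L where L: "\<And>n. L \<le> n \<Longrightarrow> x n \<in> U"
      using a UV(2,4) unfolding limitin_def eventually_sequentially by blast
    define m where "m = max N L"
    have "finprod G h F \<in> W" if F: "finite F" "A \<inter> {..<m} \<subseteq> F" "F \<subseteq> A" for F
    proof -
      have "F - {..<m} = F - {..<m} - {..<N}" by (auto simp: m_def)
      then have "finprod G h (F - {..<m}) \<in> V"
        using N[of "F - {..<m}"] F by (metis Diff_subset finite_Diff order_trans)
      moreover have "x m \<in> U" using L by (simp add: m_def)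
      ultimately show ?thesis using sum_split[OF F(1,3,2)] UV(5) by simp
    qed
    then show "\<forall>\<^sub>F F in finite_subsets_at_top A. finprod G h F \<in> W"
      unfolding eventually_finite_subsets_at_top by (intro exI[of _ "A \<inter> {..<m}"]) auto
  qed
  then show ?thesis unfolding sum_converges_def sum_converges_to_def using ac by blast
qed

text \<open>The \<open>V n\<close> stand in for balls of radius 2^-n: errors taken from
  \<open>V (Suc k)\<close>, \<open>V (Suc (Suc k))\<close> and so on accumulate to an error in
  \<open>V k\<close>. Shrinking each \<open>V n\<close> into a metric ball makes the sequence a base
  at the identity.\<close>

lemma halving_base:
  obtains V where "\<And>n. openin T (V n)" "\<And>n. \<one> \<in> V n"
    "\<And>n x y. x \<in> V (Suc n) \<Longrightarrow> y \<in> V (Suc n) \<Longrightarrow> x \<otimes> y \<in> V n"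
    "\<And>W. openin T W \<Longrightarrow> \<one> \<in> W \<Longrightarrow> \<exists>n. V n \<subseteq> W"
proof -
  obtain M d where M: "Metric_space M d" "T = Metric_space.mtopology M d"
    using polish unfolding polish_topology_def completely_metrizable_space_def by blast
  interpret Metric_space M d by fact
  have MG: "M = carrier G" using topspace_eq M(2) by simp
  define Q where "Q n V \<longleftrightarrow> openin T V \<and> \<one> \<in> V \<and> V \<subseteq> mball \<one> (inverse (Suc n))" for n V
  have ball: "openin T (mball \<one> r)" for r unfolding M(2) by simp
  have one: "\<one> \<in> M" unfolding MG by simp
  have "\<exists>V. \<forall>n. Q n (V n) \<and> (\<forall>x\<in>V (Suc n). \<forall>y\<in>V (Suc n). x \<otimes> y \<in> V n)"
  proof (rule dependent_nat_choice)
    show "\<exists>V. Q 0 V" unfolding Q_def by (intro exI[of _ "mball \<one> 1"]) (use ball one in auto)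
  next
    fix U n assume U: "Q n U"
    then obtain V where V: "openin T V" "\<one> \<in> V" "\<And>x y. x \<in> V \<Longrightarrow> y \<in> V \<Longrightarrow> x \<otimes> y \<in> U"
      using one_nbhd[of U] unfolding Q_def by blast
    let ?V = "V \<inter> mball \<one> (inverse (Suc (Suc n)))"
    have "Q (Suc n) ?V" unfolding Q_def using V(1,2) ball one by auto
    moreover have "\<forall>x\<in>?V. \<forall>y\<in>?V. x \<otimes> y \<in> U" using V(3) by blast
    ultimately show "\<exists>V. Q (Suc n) V \<and> (\<forall>x\<in>V. \<forall>y\<in>V. x \<otimes> y \<in> U)" by blast
  qed
  then obtain V where V: "\<And>n. Q n (V n)" "\<And>n. \<forall>x\<in>V (Suc n). \<forall>y\<in>V (Suc n). x \<otimes> y \<in> V n" by blast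
  show thesis
  proof (rule that[of V])
    fix W assume "openin T W" "\<one> \<in> W"
    then obtain r where r: "r > 0" "mball \<one> r \<subseteq> W" unfolding M(2) openin_mtopology by blast
    then obtain n where "inverse (real (Suc n)) < r" using reals_Archimedean by blast
    then have "mball \<one> (inverse (Suc n)) \<subseteq> mball \<one> r" by (intro mball_subset_concentric) simp
    then show "\<exists>n. V n \<subseteq> W" using V(1)[of n] r(2) unfolding Q_def by blast
  qed (use V in \<open>auto simp: Q_def\<close>)
qed

text \<open>The sets with Cauchy tails already form an ideal, proper by \<open>not_conv\<close>, so
  taking the hull adds nothing. Testing only the countably many \<open>V k\<close> brings this ideal
  into the form of \<open>analytic_familyI\<close>.\<close>

lemma summable_ideal_analytic_P_ideal:
  assumes h: "h \<in> UNIV \<rightarrow> carrier G" and not_conv: "\<not> sum_converges G T h UNIV"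
  shows "analytic_family (summable_ideal G T h) \<and> P_ideal (summable_ideal G T h)"
proof -
  obtain V where V: "\<And>n. openin T (V n)" "\<And>n. \<one> \<in> V n"
    "\<And>n x y. x \<in> V (Suc n) \<Longrightarrow> y \<in> V (Suc n) \<Longrightarrow> x \<otimes> y \<in> V n"
    "\<And>W. openin T W \<Longrightarrow> \<one> \<in> W \<Longrightarrow> \<exists>n. V n \<subseteq> W"
    using halving_base by blast
  define S where "S = {A. \<forall>k. \<exists>N. \<forall>F. finite F \<and> F \<subseteq> A \<longrightarrow> finprod G h (F - {..<N}) \<in> V k}"
  have c: "finprod G h B \<in> carrier G" for B using h by (intro finprod_closed) auto
  have S_tails: "A \<in> S \<longleftrightarrow> cauchy_tails h A" for A
  proof
    assume A: "A \<in> S"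
    show "cauchy_tails h A"
      unfolding cauchy_tails_def
    proof (intro allI impI; elim conjE)
      fix W assume "openin T W" "\<one> \<in> W"
      then obtain k where k: "V k \<subseteq> W" using V(4) by blast
      obtain N where "\<forall>F. finite F \<and> F \<subseteq> A \<longrightarrow> finprod G h (F - {..<N}) \<in> V k"
        using A unfolding S_def by blast
      then show "\<exists>N. \<forall>F. finite F \<and> F \<subseteq> A \<longrightarrow> finprod G h (F - {..<N}) \<in> W" using k by blast
    qed
  next
    assume "cauchy_tails h A"
    then show "A \<in> S" unfolding cauchy_tails_def S_def using V(1,2) by simp
  qed
  then have S_conv: "A \<in> S \<longleftrightarrow> sum_converges G T h A" for A
    using h cauchy_tails_imp_sum_converges sum_converges_imp_cauchy_tails by blast
  have S_D: "\<exists>N. \<forall>E. finite E \<and> E \<subseteq> A - {..<N} \<longrightarrow> finprod G h E \<in> V k" if A: "A \<in> S" for A k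
  proof -
    obtain N where N: "\<forall>F. finite F \<and> F \<subseteq> A \<longrightarrow> finprod G h (F - {..<N}) \<in> V k"
      using A unfolding S_def by blast
    have "finprod G h E \<in> V k" if E: "finite E" "E \<subseteq> A - {..<N}" for E
    proof -
      have "E - {..<N} = E" using E by blast
      then show ?thesis using N[rule_format, of E] E by auto
    qed
    then show ?thesis by blast
  qed
  have S_I: "A \<in> S" if A: "\<And>k. \<exists>N. \<forall>E. finite E \<and> E \<subseteq> A - {..<N} \<longrightarrow> finprod G h E \<in> V k" for A
    unfolding S_def
  proof (intro CollectI allI)
    fix k
    obtain N where "\<forall>E. finite E \<and> E \<subseteq> A - {..<N} \<longrightarrow> finprod G h E \<in> V k" using A[of k] by blast
    then show "\<exists>N. \<forall>F. finite F \<and> F \<subseteq> A \<longrightarrow> finprod G h (F - {..<N}) \<in> V k"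
      by (intro exI[of _ N] allI impI) auto
  qed
  have fin: "A \<in> S" if A: "finite A" for A
  proof (rule S_I)
    fix k
    obtain N where "A \<subseteq> {..<N}" using A finite_nat_iff_bounded by blast
    have "finprod G h E \<in> V k" if "E \<subseteq> A - {..<N}" for E
    proof -
      have "E = {}" using that \<open>A \<subseteq> {..<N}\<close> by blast
      then show ?thesis using V(2) by simp
    qed
    then show "\<exists>N. \<forall>E. finite E \<and> E \<subseteq> A - {..<N} \<longrightarrow> finprod G h E \<in> V k"
      by blast
  qed
  have sum_split: "finprod G h E \<in> V k"
    if E: "finite E" "finprod G h (E \<inter> A) \<in> V (Suc k)" "finprod G h (E - A) \<in> V (Suc k)" for E A k
  proof -
    have "E = (E \<inter> A) \<union> (E - A)" by blast
    then have "finprod G h E = finprod G h ((E \<inter> A) \<union> (E - A))" by simp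
    also have "\<dots> = finprod G h (E \<inter> A) \<otimes> finprod G h (E - A)"
      by (rule finprod_Un_disjoint) (use E(1) h in auto)
    also have "\<dots> \<in> V k" using E by (intro V(3))
    finally show ?thesis .
  qed
  have un: "A \<union> B \<in> S" if AB: "A \<in> S" "B \<in> S" for A B
  proof (rule S_I)
    fix k
    obtain N L where N: "\<And>E. finite E \<and> E \<subseteq> A - {..<N} \<Longrightarrow> finprod G h E \<in> V (Suc k)"
      and L: "\<And>E. finite E \<and> E \<subseteq> B - {..<L} \<Longrightarrow> finprod G h E \<in> V (Suc k)"
      using S_D[OF AB(1)] S_D[OF AB(2)] by meson
    have "finprod G h E \<in> V k" if E: "finite E" "E \<subseteq> A \<union> B - {..<max N L}" for E
    proof (rule sum_split[OF E(1), of A])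
      show "finprod G h (E \<inter> A) \<in> V (Suc k)" by (rule N) (use E in auto)
      show "finprod G h (E - A) \<in> V (Suc k)" by (rule L) (use E in auto)
    qed
    then show "\<exists>N. \<forall>E. finite E \<and> E \<subseteq> A \<union> B - {..<N} \<longrightarrow> finprod G h E \<in> V k" by blast
  qed
  have sub: "B \<in> S" if AB: "A \<in> S" "B \<subseteq> A" for A B
  proof (rule S_I)
    fix k
    obtain N where "\<And>E. finite E \<and> E \<subseteq> A - {..<N} \<Longrightarrow> finprod G h E \<in> V k"
      using S_D[OF AB(1)] by meson
    moreover have "B - {..<N} \<subseteq> A - {..<N}" using AB(2) by blast
    ultimately show "\<exists>N. \<forall>E. finite E \<and> E \<subseteq> B - {..<N} \<longrightarrow> finprod G h E \<in> V k"
      by (meson order_trans)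
  qed
  have "ideal_on_omega S"
    unfolding ideal_on_omega_def using sub un fin not_conv S_conv by simp
  moreover have "{A. finite A \<or> sum_converges G T h A} = S" using fin S_conv by blast
  ultimately have hull: "summable_ideal G T h = S"
    unfolding summable_ideal_def by (simp add: hull_same)
  have "analytic_family S"
    by (rule analytic_familyI[of S "\<lambda>k N F. finprod G h (F - {..<N}) \<in> V k"]) (rule S_def)
  moreover have "P_ideal S"
    unfolding P_ideal_def
  proof (intro allI impI; elim conjE)
    fix \<C> assume C: "countable \<C>" "\<C> \<subseteq> S"
    show "\<exists>A\<in>S. \<forall>C\<in>\<C>. finite (C - A)"
    proof (cases "\<C> = {}")
      case True
      then show ?thesis using fin[of "{}"] by blast
    next
      case False
      define a where "a = from_nat_into \<C>"
      have a: "range a = \<C>" unfolding a_def using False C(1) by (rule range_from_nat_into)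
      then have aS: "a i \<in> S" for i using C(2) by blast
      have "\<forall>i. \<exists>N. \<forall>E. finite E \<and> E \<subseteq> a i - {..<N} \<longrightarrow> finprod G h E \<in> V i"
        using S_D[OF aS] by blast
      then obtain N where N: "\<forall>i. \<forall>E. finite E \<and> E \<subseteq> a i - {..<N i} \<longrightarrow> finprod G h E \<in> V i"
        by (rule choice[THEN exE])
      define B where "B i = a i - {..<N i}" for i
      have B: "finprod G h E \<in> V i" if "finite E" "E \<subseteq> B i" for E i using N that unfolding B_def by blast
      \<comment> \<open>The part of \<open>E\<close> in \<open>B (Suc k)\<close> contributes an
        element of \<open>V (Suc k)\<close>, and by induction so do all later pieces
        together.\<close>
      have fin_tail: "finprod G h E \<in> V k" if "finite E" "E \<subseteq> (\<Union>i\<in>{k<..k + j}. B i)" for E j k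
        using that
      proof (induction j arbitrary: k E)
        case 0
        then show ?case using V(2) by simp
      next
        case (Suc j)
        show ?case
        proof (rule sum_split[OF Suc.prems(1), of "B (Suc k)"])
          show "finprod G h (E \<inter> B (Suc k)) \<in> V (Suc k)" using Suc.prems(1) by (intro B) auto
          show "finprod G h (E - B (Suc k)) \<in> V (Suc k)"
          proof (rule Suc.IH)
            show "E - B (Suc k) \<subseteq> (\<Union>i\<in>{Suc k<..Suc k + j}. B i)"
            proof
              fix e assume e: "e \<in> E - B (Suc k)"
              then obtain i where "i \<in> {k<..k + Suc j}" "e \<in> B i" using Suc.prems(2) by blast
              moreover from this e have "i \<noteq> Suc k" by blast
              ultimately show "e \<in> (\<Union>i\<in>{Suc k<..Suc k + j}. B i)" by (intro UN_I[of i]) auto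
            qed
          qed (use Suc.prems(1) in simp)
        qed
      qed
      have tail: "finprod G h E \<in> V k" if E: "finite E" "E \<subseteq> (\<Union>i\<in>{k<..}. B i)" for E k
      proof -
        obtain I where I: "finite I" "I \<subseteq> {k<..}" "E \<subseteq> (\<Union>i\<in>I. B i)"
          using finite_subset_Union[OF E(1), of "B ` {k<..}"] E(2)
          by (metis finite_subset_image)
        have "I \<subseteq> {k<..k + Max (insert 0 I)}"
        proof
          fix i assume i: "i \<in> I"
          then have "i \<le> Max (insert 0 I)" using I(1) by (intro Max_ge) auto
          then show "i \<in> {k<..k + Max (insert 0 I)}" using i I(2) by auto
        qed
        then have "E \<subseteq> (\<Union>i\<in>{k<..k + Max (insert 0 I)}. B i)" using I(3) by blast
        then show ?thesis using fin_tail E(1) by blast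
      qed
      define A where "A = (\<Union>i. B i)"
      have head: "(\<Union>i\<in>{..k}. B i) \<in> S" for k
      proof (induction k)
        case 0
        then show ?case using sub[OF aS[of 0], of "B 0"] by (auto simp: B_def)
      next
        case (Suc k)
        have "B (Suc k) \<in> S" by (rule sub[OF aS[of "Suc k"]]) (auto simp: B_def)
        then have "(\<Union>i\<in>{..k}. B i) \<union> B (Suc k) \<in> S" using Suc un by blast
        then show ?case by (simp add: atMost_Suc Un_commute)
      qed
      have "A \<in> S"
      proof (rule S_I)
        fix k
        \<comment> \<open>The first pieces have a union in \<open>S\<close>, so cutting at
          \<open>L\<close> makes their contribution small; the later pieces are small without a cut,
          by \<open>tail\<close>.\<close>
        obtain L where L: "\<And>E. finite E \<and> E \<subseteq> (\<Union>i\<in>{..Suc k}. B i) - {..<L} \<Longrightarrow> finprod G h E \<in> V (Suc k)"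
          using S_D[OF head] by meson
        have "finprod G h E \<in> V k" if E: "finite E" "E \<subseteq> A - {..<L}" for E
        proof (rule sum_split[OF E(1), of "\<Union>i\<in>{..Suc k}. B i"])
          show "finprod G h (E \<inter> (\<Union>i\<in>{..Suc k}. B i)) \<in> V (Suc k)"
            by (rule L) (use E in auto)
          show "finprod G h (E - (\<Union>i\<in>{..Suc k}. B i)) \<in> V (Suc k)"
          proof (rule tail)
            show "E - (\<Union>i\<in>{..Suc k}. B i) \<subseteq> (\<Union>i\<in>{Suc k<..}. B i)"
            proof
              fix e assume e: "e \<in> E - (\<Union>i\<in>{..Suc k}. B i)"
              then obtain i where "e \<in> B i" using E(2) unfolding A_def by blast
              moreover from this e have "\<not> i \<le> Suc k" by blast
              ultimately show "e \<in> (\<Union>i\<in>{Suc k<..}. B i)" by (intro UN_I[of i]) auto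
            qed
          qed (use E(1) in simp)
        qed
        then show "\<exists>N. \<forall>E. finite E \<and> E \<subseteq> A - {..<N} \<longrightarrow> finprod G h E \<in> V k" by blast
      qed
      moreover have "finite (a i - A)" for i
        by (rule finite_subset[of _ "{..<N i}"]) (auto simp: A_def B_def)
      ultimately show ?thesis using a by blast
    qed
  qed
  ultimately show ?thesis unfolding hull by blast
qed

end

lemma representable_imp_analytic_P_ideal:
  fixes G :: "'a monoid"
  assumes "polish_abelian_group G T" "representable_in J G T"
  shows "analytic_family J \<and> P_ideal J"
proof -
  interpret polish_abelian_group G T by fact
  show ?thesis using assms(2) summable_ideal_analytic_P_ideal unfolding representable_in_def by blast
qed

section \<open>Solecki's theorem\<close>

text \<open>That is, closed in the Cantor space and hereditary.\<close>

definition finite_character :: "nat set set \<Rightarrow> bool" where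
  "finite_character K \<longleftrightarrow> (\<forall>x. x \<in> K \<longleftrightarrow> (\<forall>F. finite F \<and> F \<subseteq> x \<longrightarrow> F \<in> K))"

lemma finite_characterI:
  assumes "\<And>x F. x \<in> K \<Longrightarrow> finite F \<Longrightarrow> F \<subseteq> x \<Longrightarrow> F \<in> K"
    and "\<And>x. (\<And>F. finite F \<Longrightarrow> F \<subseteq> x \<Longrightarrow> F \<in> K) \<Longrightarrow> x \<in> K"
  shows "finite_character K"
  unfolding finite_character_def
proof (intro allI iffI impI)
  fix x F assume "x \<in> K" "finite F \<and> F \<subseteq> x"
  then show "F \<in> K" using assms(1)[of x F] by simp
next
  fix x assume *: "\<forall>F. finite F \<and> F \<subseteq> x \<longrightarrow> F \<in> K"
  show "x \<in> K" by (rule assms(2)) (simp add: *)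
qed

lemma finite_character_finite_subset:
  assumes "finite_character K" "x \<in> K" "finite F" "F \<subseteq> x" shows "F \<in> K"
  using iffD1[OF assms(1)[unfolded finite_character_def, THEN spec, of x] assms(2)] assms(3-) by blast

lemma finite_character_closed:
  assumes "finite_character K" "\<And>F. finite F \<Longrightarrow> F \<subseteq> x \<Longrightarrow> F \<in> K" shows "x \<in> K"
  by (rule iffD2[OF assms(1)[unfolded finite_character_def, THEN spec, of x]]) (simp add: assms(2))

lemma finite_character_subset:
  assumes "finite_character K" "x \<in> K" "y \<subseteq> x" shows "y \<in> K"
proof (rule finite_character_closed[OF assms(1)])
  show "F \<in> K" if "finite F" "F \<subseteq> y" for F
    using finite_character_finite_subset[OF assms(1,2) that(1)] that(2) assms(3) by blast
qed

lemma finite_character_Int: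
  assumes "finite_character K" "finite_character L" shows "finite_character (K \<inter> L)"
proof (rule finite_characterI)
  fix x F assume "x \<in> K \<inter> L" "finite F" "F \<subseteq> x"
  then show "F \<in> K \<inter> L"
    using finite_character_finite_subset[OF assms(1), of x F]
      finite_character_finite_subset[OF assms(2), of x F] by simp
next
  fix x assume "\<And>F. finite F \<Longrightarrow> F \<subseteq> x \<Longrightarrow> F \<in> K \<inter> L"
  then show "x \<in> K \<inter> L"
    using finite_character_closed[OF assms(1), of x] finite_character_closed[OF assms(2), of x] by simp
qed

lemma finite_character_disjoint: "finite_character {a. a \<inter> S = {}}"
proof (rule finite_characterI)
  fix x assume F: "F \<in> {a. a \<inter> S = {}}" if "finite F" "F \<subseteq> x" for F
  have "i \<notin> S" if "i \<in> x" for i using F[of "{i}"] that by simp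
  then show "x \<in> {a. a \<inter> S = {}}" by blast
qed auto

text \<open>Finite character corresponds to lower semicontinuity and \<open>Un3\<close> to the
  triangle inequality, with three sets because a chain will be split into a left part, one link and
  a right part. \<open>C_0\<close> gives every set a cover, and \<open>C_Suc\<close> separates
  points.\<close>

locale exhausting_sequence =
  fixes C :: "nat \<Rightarrow> nat set set"
  assumes fin_char: "\<And>n. finite_character (C n)"
    and empty_in_C: "\<And>n. {} \<in> C n"
    and C_0: "C 0 = UNIV"
    and Un3: "\<And>n a b c. a \<in> C (Suc n) \<Longrightarrow> b \<in> C (Suc n) \<Longrightarrow> c \<in> C (Suc n) \<Longrightarrow> a \<union> b \<union> c \<in> C n"
    and C_Suc: "\<And>n a. a \<in> C (Suc n) \<Longrightarrow> n \<notin> a"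

text \<open>This is the family usually written Exh, of the sets whose tails tend to 0 for the
  submeasure encoded by \<open>C\<close>.\<close>

definition exhausted :: "(nat \<Rightarrow> nat set set) \<Rightarrow> nat set set" where
  "exhausted C = {x. \<forall>n. \<exists>m. x - {..<m} \<in> C n}"

lemma separable_metrizable_imp_second_countable:
  assumes "Metric_space M d" "separable_space (Metric_space.mtopology M d)"
  shows "second_countable (Metric_space.mtopology M d)"
proof -
  interpret Metric_space M d by fact
  obtain D where D: "countable D" "D \<subseteq> M" "mtopology closure_of D = M"
    using assms(2) by (auto simp: separable_space_def)
  define \<B> where "\<B> = (\<lambda>(x, n). mball x (inverse (Suc n))) ` (D \<times> (UNIV :: nat set))"
  have "\<exists>V\<in>\<B>. x \<in> V \<and> V \<subseteq> U" if U: "openin mtopology U" "x \<in> U" for U x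
  proof -
    obtain r where r: "r > 0" "mball x r \<subseteq> U" and x: "x \<in> M"
      using U openin_mtopology by (metis subsetD)
    obtain n where n: "inverse (real (Suc n)) < r / 2"
      using reals_Archimedean r(1) by (meson half_gt_zero)
    have "x \<in> mtopology closure_of D" "0 < inverse (real (Suc n))" using D(3) x by simp_all
    then obtain y where y: "y \<in> D" "y \<in> mball x (inverse (Suc n))"
      unfolding metric_closure_of by blast
    have "mball y (inverse (Suc n)) \<subseteq> mball x r"
    proof
      fix z assume z: "z \<in> mball y (inverse (Suc n))"
      then have "d x z \<le> d x y + d y z" using x by (intro triangle) simp_all
      also have "\<dots> < r" using y(2) z n unfolding in_mball by linarith
      finally show "z \<in> mball x r" using x z by simp
    qed
    moreover have "x \<in> mball y (inverse (Suc n))"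
      using y x D(2) by (auto simp: commute)
    ultimately show ?thesis
      using r(2) y(1) unfolding \<B>_def by (intro bexI[of _ "mball y (inverse (Suc n))"]) auto
  qed
  moreover have "countable \<B>" unfolding \<B>_def using D(1) by simp
  moreover have "\<forall>V\<in>\<B>. openin mtopology V" unfolding \<B>_def by auto
  ultimately show ?thesis unfolding second_countable_def by blast
qed

section \<open>Almost cofinal images and families absorbing tails\<close>

definition almost_cofinal :: "nat set set \<Rightarrow> nat set set \<Rightarrow> bool" where
  "almost_cofinal J D \<longleftrightarrow> (\<forall>x\<in>J. \<exists>z\<in>D. finite (x - z))"

lemma almost_cofinal_mono: "almost_cofinal J D \<Longrightarrow> D \<subseteq> E \<Longrightarrow> almost_cofinal J E"
  unfolding almost_cofinal_def by (meson subsetD)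

text \<open>The P-ideal property enters Solecki's theorem here. If each \<open>D\<close> failed at
  some \<open>x D\<close>, a pseudo-union of all the \<open>x D\<close> would be almost contained in
  a member of one \<open>D\<close>, and then so would the corresponding \<open>x D\<close>.\<close>

lemma almost_cofinal_Union:
  assumes "P_ideal J" "countable \<D>" "almost_cofinal J (\<Union>\<D>)"
  shows "\<exists>D\<in>\<D>. almost_cofinal J D"
proof (rule ccontr)
  assume "\<not> ?thesis"
  then have "\<forall>D\<in>\<D>. \<exists>x\<in>J. \<forall>z\<in>D. infinite (x - z)"
    unfolding almost_cofinal_def by blast
  then obtain x where x: "\<And>D. D \<in> \<D> \<Longrightarrow> x D \<in> J" "\<And>D z. D \<in> \<D> \<Longrightarrow> z \<in> D \<Longrightarrow> infinite (x D - z)"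
    by metis
  obtain A where A: "A \<in> J" "\<forall>C\<in>x ` \<D>. finite (C - A)"
    using assms(1,2) x(1) unfolding P_ideal_def
    by (metis (no_types, lifting) countable_image image_subset_iff)
  obtain z D where z: "D \<in> \<D>" "z \<in> D" "finite (A - z)"
    using assms(3) A(1) unfolding almost_cofinal_def by blast
  have "x D - z \<subseteq> (x D - A) \<union> (A - z)" by blast
  then have "finite (x D - z)"
    using A(2) z by (meson finite_Un finite_subset imageI)
  then show False using x(2) z by blast
qed

definition absorbs_tails :: "nat set set \<Rightarrow> nat set set \<Rightarrow> bool" where
  "absorbs_tails J K \<longleftrightarrow> (\<forall>x\<in>J. \<exists>m. x - {..<m} \<in> K)"

lemma absorbs_tails_Int:
  assumes "finite_character K" "finite_character L" "absorbs_tails J K" "absorbs_tails J L"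
  shows "absorbs_tails J (K \<inter> L)"
  unfolding absorbs_tails_def
proof
  fix x assume "x \<in> J"
  then obtain m n where "x - {..<m} \<in> K" "x - {..<n} \<in> L"
    using assms(3,4) unfolding absorbs_tails_def by blast
  then have "x - {..<max m n} \<in> K" "x - {..<max m n} \<in> L"
    by (auto intro: finite_character_subset[OF assms(1)] finite_character_subset[OF assms(2)])
  then show "\<exists>m. x - {..<m} \<in> K \<inter> L" by blast
qed

text \<open>
  \<open>X\<close> and \<open>g\<close> parametrise part of \<open>J\<close>. The map \<open>g\<close> need only be lower semicontinuous, and it is
  not onto \<open>J\<close>, but it is cofinal in \<open>J\<close> modulo finite sets on each nonempty open set.
\<close>

locale cofinal_parametrization =
  fixes J :: "nat set set" and X :: "'a topology" and g :: "'a \<Rightarrow> nat set"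
  assumes ideal: "ideal_on_omega J"
    and compl: "completely_metrizable_space X"
    and second_countable: "second_countable X"
    and nonempty: "topspace X \<noteq> {}"
    and g_in: "\<And>y. y \<in> topspace X \<Longrightarrow> g y \<in> J"
    and g_lsc: "\<And>n. openin X {y \<in> topspace X. n \<in> g y}"
    and g_cofinal: "\<And>U. openin X U \<Longrightarrow> U \<noteq> {} \<Longrightarrow> almost_cofinal J (g ` U)"
begin

lemma subset_in_J: "A \<in> J \<Longrightarrow> B \<subseteq> A \<Longrightarrow> B \<in> J"
  and Un_in_J: "A \<in> J \<Longrightarrow> B \<in> J \<Longrightarrow> A \<union> B \<in> J"
  and finite_in_J: "finite A \<Longrightarrow> A \<in> J"
  using ideal by (auto simp: ideal_on_omega_def)

lemma g_lsc_finite: "finite F \<Longrightarrow> openin X {y \<in> topspace X. F \<subseteq> g y}"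
proof (induction F rule: finite_induct)
  case (insert a F)
  have "{y \<in> topspace X. insert a F \<subseteq> g y}
        = {y \<in> topspace X. a \<in> g y} \<inter> {y \<in> topspace X. F \<subseteq> g y}" by auto
  then show ?case using g_lsc insert by auto
qed auto

text \<open>The closure of the hereditary closure of the image of \<open>U\<close>.\<close>

definition K :: "'a set \<Rightarrow> nat set set" where
  "K U = {x. \<forall>F. finite F \<and> F \<subseteq> x \<longrightarrow> (\<exists>y\<in>U. F \<subseteq> g y)}"

lemma K_D: "x \<in> K U \<Longrightarrow> finite F \<Longrightarrow> F \<subseteq> x \<Longrightarrow> \<exists>y\<in>U. F \<subseteq> g y"
  unfolding K_def by blast

lemma K_mono: "U \<subseteq> V \<Longrightarrow> K U \<subseteq> K V"
  unfolding K_def by blast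

lemma finite_character_K: "finite_character (K U)"
proof (rule finite_characterI)
  fix x F assume "x \<in> K U" "F \<subseteq> x"
  then show "F \<in> K U" unfolding K_def using order_trans[of _ F x] by simp
next
  fix x assume "F \<in> K U" if "finite F" "F \<subseteq> x" for F
  then have "\<exists>y\<in>U. F \<subseteq> g y" if "finite F" "F \<subseteq> x" for F
    using K_D[of F U F] that by blast
  then show "x \<in> K U" unfolding K_def by simp
qed

lemma absorbs_tails_K:
  assumes "openin X U" "U \<noteq> {}" shows "absorbs_tails J (K U)"
  unfolding absorbs_tails_def
proof
  fix x assume "x \<in> J"
  then obtain y where y: "y \<in> U" "finite (x - g y)"
    using g_cofinal[OF assms] unfolding almost_cofinal_def by blast
  then obtain m where "x - g y \<subseteq> {..<m}"
    using finite_nat_iff_bounded by blast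
  then have "x - {..<m} \<subseteq> g y" by blast
  then have "x - {..<m} \<in> K U" unfolding K_def using y(1) by blast
  then show "\<exists>m. x - {..<m} \<in> K U" ..
qed

text \<open>
  Two nested sequences of open sets are built in turn, and the pieces of \<open>x\<close> between consecutive
  cut points are covered alternately by the values of \<open>g\<close> at their limit points. The alternation
  gives one sequence the freedom to choose the cut point while the other one fixes its next set.
\<close>

lemma in_J_if_tails_in_K:
  assumes x: "\<And>U. openin X U \<Longrightarrow> U \<noteq> {} \<Longrightarrow> \<exists>m. x - {..<m} \<in> K U"
  shows "x \<in> J"
proof -
  obtain M d where M: "Metric_space M d" "Metric_space.mcomplete M d" "X = Metric_space.mtopology M d"
    using compl completely_metrizable_space_def by blast
  interpret Metric_space M d by fact
  have topX: "topspace X = M" using M by simp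
  \<comment> \<open>A state consists of the current cut point, the open set to be shrunk next and
    the open set that waits for its turn.\<close>
  define good where "good n s \<longleftrightarrow> (case s of (m, U, V) \<Rightarrow> n \<le> m \<and> openin X U \<and> U \<noteq> {} \<and> openin X V \<and> V \<noteq> {}
      \<and> x - {..<m} \<in> K U)" for n :: nat and s :: "nat \<times> 'a set \<times> 'a set"
  define nxt where "nxt n s t \<longleftrightarrow> (case (s, t) of ((m, U, V), (m', U', V')) \<Rightarrow>
      m \<le> m' \<and> U' = V \<and> X closure_of V' \<subseteq> U \<and> (\<exists>a. X closure_of V' \<subseteq> mcball a (inverse (Suc n)))
      \<and> (\<forall>y\<in>X closure_of V'. x \<inter> {m..<m'} \<subseteq> g y))" for n :: nat and s t :: "nat \<times> 'a set \<times> 'a set"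
  have "\<exists>s. \<forall>n. good n (s n) \<and> nxt n (s n) (s (Suc n))"
  proof (rule dependent_nat_choice)
    obtain m where "x - {..<m} \<in> K (topspace X)"
      using x[of "topspace X"] nonempty by auto
    then show "\<exists>s. good 0 s"
      unfolding good_def using nonempty by (intro exI[of _ "(m, topspace X, topspace X)"]) auto
  next
    fix s n assume s: "good n s"
    obtain m U V where [simp]: "s = (m, U, V)" by (cases s)
    have mUV: "n \<le> m" "openin X U" "U \<noteq> {}" "openin X V" "V \<noteq> {}" "x - {..<m} \<in> K U"
      using s by (auto simp: good_def)
    \<comment> \<open>The new cut point depends on the waiting set \<open>V\<close> alone, so that
      the next state is good whatever \<open>U\<close> shrinks to. Passing \<open>Suc m\<close>
      keeps the cut points unbounded.\<close>
    obtain m0 where m0: "x - {..<m0} \<in> K V" using x mUV by blast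
    define m' where "m' = max m0 (Suc m)"
    have m': "x - {..<m'} \<in> K V"
      by (rule finite_character_subset[OF finite_character_K m0]) (auto simp: m'_def)
    let ?F = "x \<inter> {m..<m'}"
    have "finite ?F" "?F \<subseteq> x - {..<m}" by auto
    then obtain y where y: "y \<in> U" "?F \<subseteq> g y"
      using mUV(6) unfolding K_def by blast
    \<comment> \<open>By lower semicontinuity the finite piece \<open>?F\<close> stays covered on a
      neighbourhood of \<open>y\<close>, hence at every point of the closed ball chosen inside
      it.\<close>
    define W where "W = U \<inter> {y \<in> topspace X. ?F \<subseteq> g y}"
    have W: "openin X W" "y \<in> W"
      using mUV y g_lsc_finite[of ?F] openin_subset[of X U] by (auto simp: W_def)
    then obtain r where r: "r > 0" "mball y r \<subseteq> W" and yM: "y \<in> M"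
      using openin_mtopology unfolding M(3) by (metis subsetD)
    define e where "e = min (r/2) (inverse (Suc n))"
    have e: "e > 0" "e \<le> r / 2" "e < r" "e \<le> inverse (Suc n)" using r by (auto simp: e_def min_def)
    define V' where "V' = mball y e"
    have cl: "X closure_of V' \<subseteq> mcball y e"
      unfolding V'_def M(3) by (intro closure_of_minimal) auto
    have "mcball y e \<subseteq> mball y r" using e by auto
    then have "X closure_of V' \<subseteq> W" using cl r(2) by blast
    moreover have "openin X V'" "V' \<noteq> {}" unfolding V'_def M(3) using e yM by auto
    moreover have "X closure_of V' \<subseteq> mcball y (inverse (Suc n))" using cl e(4) by auto
    ultimately have "good (Suc n) (m', V, V')" "nxt n s (m', V, V')"
      using mUV m' unfolding good_def nxt_def W_def by (auto simp: m'_def)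
    then show "\<exists>t. good (Suc n) t \<and> nxt n s t" by blast
  qed
  then obtain s where s: "\<And>n. good n (s n)" "\<And>n. nxt n (s n) (s (Suc n))" by blast
  define m where "m n = fst (s n)" for n
  define V where "V n = snd (snd (s n))" for n
  have good: "n \<le> m n" "openin X (V n)" "V n \<noteq> {}" for n
    using s(1)[of n] unfolding good_def m_def V_def by (auto split: prod.splits)
  have V2: "X closure_of V (Suc (Suc n)) \<subseteq> V n"
    and small: "\<exists>a. X closure_of V (Suc n) \<subseteq> mcball a (inverse (Suc n))"
    and cover: "y \<in> X closure_of V (Suc n) \<Longrightarrow> x \<inter> {m n..<m (Suc n)} \<subseteq> g y"
    and mono: "m n \<le> m (Suc n)" for n y
    using s(2)[of n] s(2)[of "Suc n"] unfolding nxt_def m_def V_def by (auto split: prod.splits)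
  \<comment> \<open>By \<open>V2\<close> the sets whose indices have the same parity are nested;
    \<open>p\<close> selects the parity.\<close>
  have limit: "\<exists>y\<in>topspace X. \<forall>n. y \<in> X closure_of V (2 * n + p)" for p
  proof -
    let ?C = "\<lambda>n. X closure_of V (2 * n + p)"
    have dec: "decseq ?C"
    proof (rule decseq_SucI)
      fix n
      have "?C (Suc n) \<subseteq> V (2 * n + p)" using V2[of "2 * n + p"] by simp
      also have "\<dots> \<subseteq> ?C n" using good(2) closure_of_subset openin_subset by metis
      finally show "?C (Suc n) \<subseteq> ?C n" .
    qed
    have ne: "?C n \<noteq> {}" for n
      using good(2,3) closure_of_subset openin_subset by (metis subset_empty)
    have sm: "\<exists>n a. ?C n \<subseteq> mcball a \<epsilon>" if \<epsilon>: "\<epsilon> > 0" for \<epsilon>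
    proof -
      obtain n where n: "inverse (real (Suc n)) < \<epsilon>" using reals_Archimedean[OF \<epsilon>] by blast
      define k where "k = 2 * n + 1 + p"
      have k: "2 * Suc n + p = Suc k" "n \<le> k" by (simp_all add: k_def)
      obtain a where "?C (Suc n) \<subseteq> mcball a (inverse (Suc k))"
        using small[of k] unfolding k(1) by blast
      moreover have "inverse (real (Suc k)) \<le> inverse (real (Suc n))"
        by (rule le_imp_inverse_le) (use k(2) in auto)
      then have "inverse (real (Suc k)) \<le> \<epsilon>" using n by linarith
      ultimately have "?C (Suc n) \<subseteq> mcball a \<epsilon>"
        by (meson mcball_subset_concentric order_trans)
      then show ?thesis by blast
    qed
    have "\<Inter> (range ?C) \<noteq> {}"
    proof (rule mcomplete_nest[THEN iffD1, OF M(2), rule_format], intro conjI allI impI)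
      show "closedin mtopology (?C n)" for n using M(3) by simp
    qed (use dec ne sm in blast)+
    then obtain y where "\<And>n. y \<in> ?C n" by auto
    then show ?thesis using closure_of_subset_topspace by (metis subsetD)
  qed
  obtain y where y: "y \<in> topspace X" "\<And>n. y \<in> X closure_of V (2 * n + 0)" using limit by blast
  obtain z where z: "z \<in> topspace X" "\<And>n. z \<in> X closure_of V (2 * n + 1)" using limit by blast
  have "x \<subseteq> {..<m 0} \<union> (g y \<union> g z)"
  proof
    fix i assume i: "i \<in> x"
    show "i \<in> {..<m 0} \<union> (g y \<union> g z)"
    proof (cases "i < m 0")
      case False
      define n where "n = (LEAST n. i < m n)"
      have "i < m (Suc i)" using good(1)[of "Suc i"] by simp
      then have n: "i < m n" unfolding n_def by (rule LeastI)
      with False have "n \<noteq> 0" by (cases n) auto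
      then obtain k where k: "n = Suc k" using not0_implies_Suc by blast
      moreover have "\<not> i < m k" using not_less_Least[of k "\<lambda>n. i < m n"] k n_def by simp
      ultimately have ik: "i \<in> x \<inter> {m k..<m (Suc k)}" using i n by simp
      \<comment> \<open>The piece from \<open>m k\<close> to \<open>m (Suc k)\<close> is covered by
        the limit point whose sequence contains the index \<open>Suc k\<close>.\<close>
      have "Suc k = 2 * (Suc k div 2) + 0 \<or> Suc k = 2 * (Suc k div 2) + 1" by arith
      then have "y \<in> X closure_of V (Suc k) \<or> z \<in> X closure_of V (Suc k)"
        using y(2) z(2) by metis
      then show ?thesis using cover ik by blast
    qed auto
  qed
  then show ?thesis
    using subset_in_J Un_in_J finite_in_J g_in y(1) z(1) by (meson finite_lessThan)
qed

text \<open>The closed sets \<open>E m\<close> cover the square of \<open>X\<close>, because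
  \<open>J\<close> is closed under unions and \<open>L\<close> absorbs tails. By the Baire category
  theorem one of them contains a box of nonempty open sets \<open>U\<close> and \<open>V\<close>,
  and finite subsets of members of \<open>K U\<close> and \<open>K V\<close> are covered by values
  of \<open>g\<close> at points of this box.\<close>

lemma halving:
  assumes L: "finite_character L" "absorbs_tails J L"
  shows "\<exists>L'. finite_character L' \<and> absorbs_tails J L' \<and> (\<forall>a\<in>L'. \<forall>b\<in>L'. a \<union> b \<in> L)"
proof -
  define P where "P = prod_topology X X"
  define E where "E m = {(y, z). y \<in> topspace X \<and> z \<in> topspace X \<and> (g y \<union> g z) - {..<m} \<in> L}" for m
  have cm: "completely_metrizable_space P"
    unfolding P_def using compl by (simp add: completely_metrizable_space_prod_topology)
  have clo: "closedin P (E m)" for m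
    unfolding closedin_def
  proof
    show "E m \<subseteq> topspace P" by (auto simp: E_def P_def)
    show "openin P (topspace P - E m)"
      unfolding P_def openin_prod_topology_alt
    proof (intro allI impI)
      fix y z assume "(y, z) \<in> topspace (prod_topology X X) - E m"
      then have yz: "y \<in> topspace X" "z \<in> topspace X" "(g y \<union> g z) - {..<m} \<notin> L"
        by (auto simp: E_def)
      \<comment> \<open>A finite \<open>F\<close> witnesses that \<open>(y, z)\<close> is outside
        \<open>E m\<close>, and by lower semicontinuity it remains a witness nearby.\<close>
      then obtain F where F: "finite F" "F \<subseteq> (g y \<union> g z) - {..<m}" "F \<notin> L"
        using finite_character_closed[OF L(1), of "(g y \<union> g z) - {..<m}"] by blast
      define U where "U = {y' \<in> topspace X. F \<inter> g y \<subseteq> g y'}"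
      define V where "V = {z' \<in> topspace X. F \<inter> g z \<subseteq> g z'}"
      have "U \<times> V \<subseteq> topspace (prod_topology X X) - E m"
      proof clarify
        fix y' z' assume *: "y' \<in> U" "z' \<in> V"
        have "F \<subseteq> (g y' \<union> g z') - {..<m}" using * F(2) unfolding U_def V_def by blast
        then have "(g y' \<union> g z') - {..<m} \<notin> L"
          using F(3) finite_character_subset[OF L(1)] by blast
        then show "(y', z') \<in> topspace (prod_topology X X) - E m"
          using * by (auto simp: E_def U_def V_def)
      qed
      moreover have "openin X U" "openin X V" "y \<in> U" "z \<in> V"
        unfolding U_def V_def using yz F(1) by (auto intro!: g_lsc_finite)
      ultimately show "\<exists>U V. openin X U \<and> openin X V \<and> y \<in> U \<and> z \<in> V
          \<and> U \<times> V \<subseteq> topspace (prod_topology X X) - E m" by blast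
    qed
  qed
  have "\<Union>(range E) = topspace P"
  proof (intro subset_antisym subsetI)
    fix p assume "p \<in> topspace P"
    then obtain y z where p: "p = (y, z)" "y \<in> topspace X" "z \<in> topspace X"
      by (auto simp: P_def)
    then have "g y \<union> g z \<in> J" using g_in Un_in_J by blast
    then obtain m where "(g y \<union> g z) - {..<m} \<in> L"
      using L(2) unfolding absorbs_tails_def by blast
    then show "p \<in> \<Union>(range E)" using p by (auto simp: E_def)
  qed (auto simp: E_def P_def)
  then have "P interior_of \<Union>(range E) \<noteq> {}"
    using nonempty interior_of_topspace[of P] unfolding P_def by force
  then obtain m where "P interior_of (E m) \<noteq> {}"
    using Baire_category_alt[of P "range E"] cm clo by fastforce
  then obtain y z where "(y, z) \<in> P interior_of (E m)" by fastforce
  moreover have "openin P (P interior_of (E m))" by simp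
  ultimately obtain U V where UV: "openin X U" "openin X V" "y \<in> U" "z \<in> V" "U \<times> V \<subseteq> E m"
    unfolding P_def openin_prod_topology_alt by (meson dual_order.trans interior_of_subset)
  \<comment> \<open>Membership in \<open>E m\<close> controls only what lies at or above
    \<open>m\<close>, so \<open>N\<close> forbids everything below.\<close>
  define N where "N = {a::nat set. a \<inter> {..<m} = {}}"
  have N: "finite_character N" unfolding N_def by (rule finite_character_disjoint)
  have N': "absorbs_tails J N" unfolding N_def absorbs_tails_def by blast
  define L' where "L' = N \<inter> (K U \<inter> K V)"
  show ?thesis
  proof (intro exI[of _ L'] conjI ballI)
    show "finite_character L'" unfolding L'_def
      by (intro finite_character_Int N finite_character_K)
    show "absorbs_tails J L'" unfolding L'_def using UV
      by (intro absorbs_tails_Int finite_character_Int N N' finite_character_K absorbs_tails_K) auto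
    fix a b assume ab: "a \<in> L'" "b \<in> L'"
    then have *: "a \<in> N" "b \<in> N" "a \<in> K U" "b \<in> K V" by (auto simp: L'_def)
    show "a \<union> b \<in> L"
    proof (rule finite_character_closed[OF L(1)])
      fix F assume F: "finite F" "F \<subseteq> a \<union> b"
      obtain y' where y': "y' \<in> U" "F \<inter> a \<subseteq> g y'"
        using K_D[OF *(3), of "F \<inter> a"] F(1) by blast
      obtain z' where z': "z' \<in> V" "F \<inter> b \<subseteq> g z'"
        using K_D[OF *(4), of "F \<inter> b"] F(1) by blast
      have "(y', z') \<in> E m" using y' z' UV by blast
      moreover have "F \<subseteq> (g y' \<union> g z') - {..<m}"
        using F * y' z' unfolding N_def by blast
      ultimately show "F \<in> L"
        using finite_character_subset[OF L(1)] unfolding E_def by blast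
    qed
  qed
qed

end

text \<open>Each \<open>C (Suc n)\<close> is obtained by halving twice below \<open>C n\<close>,
  below \<open>K\<close> of the \<open>n\<close>-th basic open set and below the sets omitting
  \<open>n\<close>. A set with tails in all \<open>C n\<close> then has tails in \<open>K U\<close>
  for every nonempty open \<open>U\<close>, so \<open>in_J_if_tails_in_K\<close> applies.\<close>

lemma (in cofinal_parametrization) exhausting:
  "\<exists>C. exhausting_sequence C \<and> J = exhausted C"
proof -
  obtain \<B>0 where B0: "countable \<B>0" "\<forall>V\<in>\<B>0. openin X V"
    "\<forall>U x. openin X U \<and> x \<in> U \<longrightarrow> (\<exists>V\<in>\<B>0. x \<in> V \<and> V \<subseteq> U)"
    using second_countable unfolding second_countable_def by blast
  \<comment> \<open>\<open>absorbs_tails_K\<close> applies to nonempty open sets only; adding the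
    whole space ensures that there is something to enumerate.\<close>
  define \<B> where "\<B> = insert (topspace X) (\<B>0 - {{}})"
  define B where "B = from_nat_into \<B>"
  have B: "range B = \<B>"
    unfolding B_def by (rule range_from_nat_into) (auto simp: \<B>_def B0(1))
  have BO: "openin X (B n)" "B n \<noteq> {}" for n
  proof -
    have "B n \<in> \<B>" using B by blast
    then show "openin X (B n)" "B n \<noteq> {}" using B0(2) nonempty by (auto simp: \<B>_def)
  qed
  \<comment> \<open>The last clause fixes the first term of the sequence obtained by dependent
    choice.\<close>
  define Q where "Q n D \<longleftrightarrow> finite_character D \<and> absorbs_tails J D \<and> (n = 0 \<longrightarrow> D = UNIV)"
    for n :: nat and D
  define R where "R n D D' \<longleftrightarrow> (\<forall>a\<in>D'. \<forall>b\<in>D'. \<forall>c\<in>D'. a \<union> b \<union> c \<in> D \<and> n \<notin> a \<and> a \<in> K (B n))" for n D D'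
  have "\<exists>C. \<forall>n. Q n (C n) \<and> R n (C n) (C (Suc n))"
  proof (rule dependent_nat_choice)
    have "Q 0 UNIV" unfolding Q_def finite_character_def absorbs_tails_def by blast
    then show "\<exists>D. Q 0 D" ..
  next
    fix D n assume D: "Q n D"
    define N where "N = {a::nat set. a \<inter> {n} = {}}"
    define L where "L = N \<inter> (D \<inter> K (B n))"
    have N: "finite_character N" "absorbs_tails J N"
      unfolding N_def absorbs_tails_def
      by (rule finite_character_disjoint) (auto intro!: exI[of _ "Suc n"])
    have fD: "finite_character D" "absorbs_tails J D" using D by (auto simp: Q_def)
    have "finite_character L" "absorbs_tails J L"
      unfolding L_def using N fD BO
      by (auto intro!: absorbs_tails_Int finite_character_Int N finite_character_K absorbs_tails_K)
    from halving[OF this] obtain L1 where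
      L1: "finite_character L1" "absorbs_tails J L1" "\<forall>a\<in>L1. \<forall>b\<in>L1. a \<union> b \<in> L" by blast
    from halving[OF L1(1,2)] obtain L2 where
      L2: "finite_character L2" "absorbs_tails J L2" "\<forall>a\<in>L2. \<forall>b\<in>L2. a \<union> b \<in> L1" by blast
    have un: "a \<union> b \<union> c \<in> L" if abc: "a \<in> L2" "b \<in> L2" "c \<in> L2" for a b c
    proof -
      have "a \<union> b \<in> L1" "c \<union> c \<in> L1" using L2(3) abc by blast+
      then show ?thesis using L1(3) by fastforce
    qed
    have "a \<in> L" if "a \<in> L2" for a using un[OF that that that] by simp
    then have "Q (Suc n) L2 \<and> R n D L2"
      using L2(1,2) un unfolding Q_def R_def L_def N_def by simp
    then show "\<exists>D'. Q (Suc n) D' \<and> R n D D'" by blast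
  qed
  then obtain C where C: "\<And>n. Q n (C n)" "\<And>n. R n (C n) (C (Suc n))" by blast
  have "exhausting_sequence C"
  proof
    have "absorbs_tails J (C n)" for n using C(1) by (simp add: Q_def)
    then show "{} \<in> C n" for n
      using finite_in_J[of "{}"] unfolding absorbs_tails_def by fastforce
    show "finite_character (C n)" "C 0 = UNIV" for n using C(1) by (simp_all add: Q_def)
    show "a \<union> b \<union> c \<in> C n" if "a \<in> C (Suc n)" "b \<in> C (Suc n)" "c \<in> C (Suc n)" for n a b c
      using C(2)[of n] that by (simp add: R_def)
    show "n \<notin> a" if "a \<in> C (Suc n)" for n a
      using C(2)[of n] that by (auto simp: R_def)
  qed
  moreover have "J = exhausted C"
    unfolding exhausted_def
  proof (intro subset_antisym subsetI)
    fix x assume "x \<in> J"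
    then show "x \<in> {x. \<forall>n. \<exists>m. x - {..<m} \<in> C n}"
      using C(1) unfolding Q_def absorbs_tails_def by blast
  next
    fix x assume x: "x \<in> {x. \<forall>n. \<exists>m. x - {..<m} \<in> C n}"
    show "x \<in> J"
    proof (rule in_J_if_tails_in_K)
      fix U assume U: "openin X U" "U \<noteq> {}"
      then obtain V where V: "V \<in> \<B>0" "V \<noteq> {}" "V \<subseteq> U" using B0(3) by blast
      then obtain n where n: "B n = V" using B unfolding \<B>_def by (metis DiffI insertI2 rangeE singletonD)
      obtain m where "x - {..<m} \<in> C (Suc n)" using x by blast
      then have "x - {..<m} \<in> K V" using C(2)[of n] n unfolding R_def by blast
      then show "\<exists>m. x - {..<m} \<in> K U" using K_mono V(3) by blast
    qed
  qed
  ultimately show ?thesis by blast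
qed

text \<open>Removing the countably many basic open sets whose image is not almost cofinal preserves
  the almost cofinality of every other image, by \<open>almost_cofinal_Union\<close>. A nonempty
  relatively open part of the remainder \<open>S\<close> contains the trace of a basic set that was
  not removed.\<close>

lemma analytic_P_ideal_parametrization:
  assumes "ideal_on_omega J" "analytic_family J" "P_ideal J"
  shows "\<exists>(X :: (nat \<Rightarrow> nat) topology) g. cofinal_parametrization J X g"
proof -
  obtain Y :: "(nat \<Rightarrow> nat) topology" and f where Y: "polish_topology Y" "continuous_map Y cantor_space f"
      "f ` topspace Y = (\<lambda>A n. n \<in> A) ` J"
    using assms(2) unfolding analytic_family_def analytic_in_def by blast
  have cY: "completely_metrizable_space Y" using Y unfolding polish_topology_def by blast
  have sY: "second_countable Y"
  proof -
    obtain M d where "Metric_space M d" "Y = Metric_space.mtopology M d"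
      using cY unfolding completely_metrizable_space_def by blast
    then show ?thesis
      using Y(1) separable_metrizable_imp_second_countable unfolding polish_topology_def by blast
  qed
  define g where "g y = {n. f y n}" for y
  have gJ: "g ` topspace Y = J"
  proof -
    have "g ` topspace Y = (\<lambda>h. {n. h n}) ` (f ` topspace Y)" unfolding g_def by auto
    also have "\<dots> = J" unfolding Y(3) by (auto simp: image_image)
    finally show ?thesis .
  qed
  have lsc: "openin Y {y \<in> topspace Y. n \<in> g y}" for n
  proof -
    have "continuous_map Y (discrete_topology UNIV) (\<lambda>y. f y n)"
      using Y(2) unfolding cantor_space_def by (metis continuous_map_componentwise_UNIV)
    then have "openin Y {y \<in> topspace Y. f y n \<in> {True}}"
      by (rule openin_continuous_map_preimage) auto
    then show ?thesis by (simp add: g_def)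
  qed
  obtain \<B> where B: "countable \<B>" "\<forall>V\<in>\<B>. openin Y V"
    "\<forall>U x. openin Y U \<and> x \<in> U \<longrightarrow> (\<exists>V\<in>\<B>. x \<in> V \<and> V \<subseteq> U)"
    using sY unfolding second_countable_def by blast
  define Bad where "Bad = {V \<in> \<B>. \<not> almost_cofinal J (g ` V)}"
  define S where "S = topspace Y - \<Union>Bad"
  have clS: "closedin Y S"
    unfolding S_def using B(2) by (intro closedin_diff) (auto simp: Bad_def)
  have cof: "almost_cofinal J (g ` (U \<inter> S))" if U: "openin Y U" "almost_cofinal J (g ` U)" for U
  proof -
    \<comment> \<open>These countably many images cover the image of \<open>U\<close>; those coming
      from \<open>Bad\<close> are not almost cofinal, which leaves the first.\<close>
    let ?D = "insert (g ` (U \<inter> S)) ((`) g ` Bad)"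
    have "g ` U \<subseteq> \<Union>?D"
      using openin_subset[OF U(1)] unfolding S_def by blast
    then have "almost_cofinal J (\<Union>?D)" using almost_cofinal_mono U(2) by blast
    moreover have "countable ?D" using B(1) unfolding Bad_def by simp
    ultimately obtain D where "D \<in> ?D" "almost_cofinal J D"
      using almost_cofinal_Union[OF assms(3)] by blast
    then show ?thesis by (auto simp: Bad_def)
  qed
  have "almost_cofinal J (g ` topspace Y)"
    unfolding gJ almost_cofinal_def by (metis Diff_cancel finite.emptyI)
  then have "almost_cofinal J (g ` (topspace Y \<inter> S))" by (intro cof) auto
  moreover have "{} \<in> J" using assms(1) unfolding ideal_on_omega_def by blast
  ultimately have ne: "topspace Y \<inter> S \<noteq> {}" unfolding almost_cofinal_def by blast
  let ?X = "subtopology Y S"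
  have "cofinal_parametrization J ?X g"
  proof
    show "completely_metrizable_space ?X" using cY clS by (rule completely_metrizable_space_closedin)
    show "second_countable ?X" using sY by (rule second_countable_subtopology)
    show "topspace ?X \<noteq> {}" using ne by simp
    show "g y \<in> J" if "y \<in> topspace ?X" for y using that gJ by auto
    show "openin ?X {y \<in> topspace ?X. n \<in> g y}" for n
      unfolding openin_subtopology using lsc[of n] by (intro exI[of _ "{y \<in> topspace Y. n \<in> g y}"]) auto
    show "almost_cofinal J (g ` U)" if U: "openin ?X U" "U \<noteq> {}" for U
    proof -
      obtain W where W: "openin Y W" "U = W \<inter> S" using U(1) by (auto simp: openin_subtopology)
      then obtain y where y: "y \<in> W" "y \<in> S" using U(2) by blast
      then obtain V where V: "V \<in> \<B>" "y \<in> V" "V \<subseteq> W" using B(3) W by blast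
      then have "V \<notin> Bad" using y(2) unfolding S_def by blast
      then have "almost_cofinal J (g ` V)" using V(1) unfolding Bad_def by blast
      then have "almost_cofinal J (g ` (V \<inter> S))" using cof B(2) V(1) by blast
      then show ?thesis by (rule almost_cofinal_mono) (use W(2) V(3) in blast)
    qed
  qed fact
  then show ?thesis by blast
qed

lemma analytic_P_ideal_exhausting:
  assumes "ideal_on_omega J" "analytic_family J" "P_ideal J"
  shows "\<exists>C. exhausting_sequence C \<and> J = exhausted C"
proof -
  obtain X :: "(nat \<Rightarrow> nat) topology" and g where "cofinal_parametrization J X g"
    using analytic_P_ideal_parametrization[OF assms] by blast
  then show ?thesis by (rule cofinal_parametrization.exhausting)
qed

section \<open>The group of an exhausting sequence\<close>

text \<open>An entry \<open>(n, c)\<close> stands for a set \<open>c\<close> of \<open>C n\<close>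
  at the price 2^-n. Lists count repetitions and carry the order along which a cover is
  split.\<close>

definition weight :: "(nat \<times> nat set) list \<Rightarrow> real" where
  "weight ps = (\<Sum>(n, c)\<leftarrow>ps. (1/2) ^ n)"

lemma weight_simps [simp]:
  "weight [] = 0" "weight ((n, c) # ps) = (1/2) ^ n + weight ps" "weight (ps @ qs) = weight ps + weight qs"
  by (auto simp: weight_def)

lemma weight_nonneg: "0 \<le> weight ps"
  by (induction ps) (auto simp: weight_def)

text \<open>The middle entry is the first one after which less than \<open>h\<close> remains. If it
  is not the head of the list, it and its successors weigh at least \<open>h\<close>, which leaves
  less than \<open>h\<close> in front of it.\<close>

lemma split_weight:
  assumes "weight ps < 2 * h" "ps \<noteq> []" "h > 0"
  shows "\<exists>p q s. ps = p @ q # s \<and> weight p < h \<and> weight s < h"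
proof -
  define j where "j = (LEAST j. weight (drop (Suc j) ps) < h)"
  have 1: "weight (drop (Suc (length ps - 1)) ps) < h" using assms by simp
  then have j: "weight (drop (Suc j) ps) < h" unfolding j_def by (rule LeastI)
  have "j \<le> length ps - 1" unfolding j_def using 1 by (rule Least_le)
  then have jl: "j < length ps" using assms(2) by (cases ps) auto
  have "weight (take j ps) < h"
  proof (cases j)
    case (Suc i)
    then have "i < j" by simp
    then have "\<not> weight (drop (Suc i) ps) < h" 
      unfolding j_def by (rule not_less_Least[of i "\<lambda>j. weight (drop (Suc j) ps) < h"])
    moreover have "weight (take j ps) + weight (drop j ps) = weight ps"
      by (metis append_take_drop_id weight_simps(3))
    ultimately show ?thesis using assms(1) unfolding Suc by linarith
  qed (use assms in simp)
  moreover have "ps = take j ps @ ps ! j # drop (Suc j) ps" using jl by (rule id_take_nth_drop)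
  ultimately show ?thesis using j by blast
qed

section \<open>The submeasure of an exhausting sequence\<close>

context exhausting_sequence
begin

lemma C_subset: "a \<in> C n \<Longrightarrow> b \<subseteq> a \<Longrightarrow> b \<in> C n"
  by (rule finite_character_subset[OF fin_char])

lemma C_antimono: "m \<le> n \<Longrightarrow> C n \<subseteq> C m"
proof (rule lift_Suc_antimono_le[of C])
  show "C (Suc n) \<subseteq> C n" for n
  proof
    fix a assume "a \<in> C (Suc n)"
    then have "a \<union> a \<union> a \<in> C n" by (intro Un3)
    then show "a \<in> C n" by simp
  qed
qed

definition covers :: "(nat \<times> nat set) list \<Rightarrow> nat set \<Rightarrow> bool" where
  "covers ps a \<longleftrightarrow> (\<forall>(n, c)\<in>set ps. c \<in> C n) \<and> a \<subseteq> (\<Union>(n, c)\<in>set ps. c)"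

text \<open>This is the Birkhoff-Kakutani infimum over chains: the largest submeasure that is at
  most 2^-n on each \<open>C n\<close>.\<close>

definition \<phi> :: "nat set \<Rightarrow> real" where
  "\<phi> a = Inf {weight ps |ps. covers ps a}"

lemma covers_self: "a \<in> C n \<Longrightarrow> covers [(n, a)] a"
  by (auto simp: covers_def)

lemma covers_Un: "covers ps a \<Longrightarrow> covers qs b \<Longrightarrow> covers (ps @ qs) (a \<union> b)"
  by (auto simp: covers_def)

lemma covers_mono: "covers ps b \<Longrightarrow> a \<subseteq> b \<Longrightarrow> covers ps a"
  unfolding covers_def by (meson order_trans)

lemma bdd_below_weights: "bdd_below {weight ps |ps. covers ps a}"
  using weight_nonneg by (auto intro!: bdd_belowI[of _ 0])

lemma \<phi>_le: "covers ps a \<Longrightarrow> \<phi> a \<le> weight ps"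
  unfolding \<phi>_def by (rule cInf_lower[OF _ bdd_below_weights]) blast

lemma weights_nonempty: "{weight ps |ps. covers ps a} \<noteq> {}"
  using covers_self[of a 0] C_0 by blast

lemma \<phi>_less_iff: "\<phi> a < r \<longleftrightarrow> (\<exists>ps. covers ps a \<and> weight ps < r)"
  unfolding \<phi>_def using cInf_less_iff[OF weights_nonempty bdd_below_weights] by blast

lemma \<phi>_nonneg: "0 \<le> \<phi> a"
  unfolding \<phi>_def by (rule cInf_greatest[OF weights_nonempty]) (use weight_nonneg in auto)

lemma \<phi>_empty: "\<phi> {} = 0"
  using \<phi>_le[of "[]" "{}"] \<phi>_nonneg[of "{}"] by (simp add: covers_def)

lemma \<phi>_Un_le: "\<phi> (a \<union> b) \<le> \<phi> a + \<phi> b"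
proof (rule field_le_epsilon)
  fix e :: real assume "e > 0"
  then have "\<phi> a < \<phi> a + e / 2" "\<phi> b < \<phi> b + e / 2" by auto
  then obtain ps qs where "covers ps a" "weight ps < \<phi> a + e / 2" "covers qs b" "weight qs < \<phi> b + e / 2"
    unfolding \<phi>_less_iff by blast
  moreover from this have "\<phi> (a \<union> b) \<le> weight (ps @ qs)" by (intro \<phi>_le covers_Un)
  ultimately show "\<phi> (a \<union> b) \<le> \<phi> a + \<phi> b + e" by simp
qed

lemma \<phi>_mono: "a \<subseteq> b \<Longrightarrow> \<phi> a \<le> \<phi> b"
  unfolding \<phi>_def by (intro cInf_superset_mono weights_nonempty bdd_below_weights) (auto intro: covers_mono)

lemma \<phi>_le_if_in_C: "a \<in> C n \<Longrightarrow> \<phi> a \<le> (1/2) ^ n"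
  using \<phi>_le[OF covers_self] by simp

text \<open>A chain lighter than 2^-n splits around one entry into two parts lighter than half of
  that. The parts are in \<open>C (Suc n)\<close> by induction; the entry is there since its own
  price is below 2^-n, so that its index exceeds \<open>n\<close>. \<open>Un3\<close> joins the
  three.\<close>

lemma Union_cover_in_C:
  assumes "\<forall>(k, c)\<in>set ps. c \<in> C k" "weight ps < (1/2) ^ n"
  shows "(\<Union>(k, c)\<in>set ps. c) \<in> C n"
  using assms
proof (induction "length ps" arbitrary: ps n rule: less_induct)
  case less
  show ?case
  proof (cases "ps = []")
    case True
    then show ?thesis using empty_in_C by simp
  next
    case False
    have "\<exists>p q s. ps = p @ q # s \<and> weight p < (1/2) ^ Suc n \<and> weight s < (1/2) ^ Suc n"
      by (rule split_weight) (use less.prems(2) False in auto)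
    then obtain p q s where ps: "ps = p @ q # s" "weight p < (1/2) ^ Suc n" "weight s < (1/2) ^ Suc n"
      by blast
    obtain k c where q: "q = (k, c)" by (cases q)
    have "(1/2::real) ^ k < (1/2) ^ n"
      using less.prems(2) weight_nonneg[of p] weight_nonneg[of s]
      unfolding ps(1) q weight_simps by linarith
    then have "n < k" by (simp add: power_strict_decreasing_iff)
    moreover have "c \<in> C k" using less.prems(1) ps q by auto
    ultimately have "c \<in> C (Suc n)" using C_antimono[of "Suc n" k] by (simp add: Suc_le_eq subset_iff)
    moreover have "(\<Union>(k, c)\<in>set p. c) \<in> C (Suc n)" "(\<Union>(k, c)\<in>set s. c) \<in> C (Suc n)"
      using less.hyps[of p] less.hyps[of s] less.prems(1) ps by auto
    ultimately have "(\<Union>(k, c)\<in>set p. c) \<union> c \<union> (\<Union>(k, c)\<in>set s. c) \<in> C n" by (intro Un3)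
    moreover have "(\<Union>(k, c)\<in>set ps. c) = (\<Union>(k, c)\<in>set p. c) \<union> c \<union> (\<Union>(k, c)\<in>set s. c)"
      unfolding ps(1) q by auto
    ultimately show ?thesis by simp
  qed
qed

text \<open>Together with \<open>\<phi>_le_if_in_C\<close> this interleaves the sets
  \<open>C n\<close> with the balls of \<open>\<phi>\<close>, so \<open>exhausted C\<close> is the
  exhaustive ideal of \<open>\<phi>\<close>.\<close>

lemma in_C_if_\<phi>_less:
  assumes "\<phi> a < (1/2) ^ n" shows "a \<in> C n"
proof -
  obtain ps where "covers ps a" "weight ps < (1/2) ^ n"
    using assms unfolding \<phi>_less_iff by blast
  then show ?thesis
    unfolding covers_def by (intro C_subset[OF Union_cover_in_C[of ps n], of a]) simp_all
qed

lemma \<phi>_eq_0_iff: "\<phi> a = 0 \<longleftrightarrow> a = {}"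
proof
  assume "\<phi> a = 0"
  then have "a \<in> C (Suc n)" for n by (intro in_C_if_\<phi>_less) simp
  then show "a = {}" using C_Suc by blast
qed (simp add: \<phi>_empty)

lemma exhausted_subset:
  assumes "x \<in> exhausted C" "y \<subseteq> x" shows "y \<in> exhausted C"
  unfolding exhausted_def
proof safe
  fix n
  obtain m where "x - {..<m} \<in> C n" using assms(1) unfolding exhausted_def by blast
  then have "y - {..<m} \<in> C n" by (rule C_subset) (use assms(2) in blast)
  then show "\<exists>m. y - {..<m} \<in> C n" ..
qed

lemma exhausted_Un:
  assumes "x \<in> exhausted C" "y \<in> exhausted C" shows "x \<union> y \<in> exhausted C"
  unfolding exhausted_def
proof safe
  fix n
  obtain k l where "x - {..<k} \<in> C (Suc n)" "y - {..<l} \<in> C (Suc n)"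
    using assms unfolding exhausted_def by blast
  then have "(x - {..<k}) \<union> (y - {..<l}) \<union> {} \<in> C n" using empty_in_C by (rule Un3)
  then have "x \<union> y - {..<max k l} \<in> C n" by (rule C_subset) auto
  then show "\<exists>m. x \<union> y - {..<m} \<in> C n" ..
qed

lemma finite_exhausted:
  assumes "finite x" shows "x \<in> exhausted C"
proof -
  obtain m where "x \<subseteq> {..<m}" using assms finite_nat_iff_bounded by blast
  then have "x - {..<m} \<in> C n" for n using empty_in_C by (simp add: Diff_eq_empty_iff[THEN iffD2])
  then show ?thesis unfolding exhausted_def by blast
qed

lemma exhausted_sym_diff: "x \<in> exhausted C \<Longrightarrow> y \<in> exhausted C \<Longrightarrow> sym_diff x y \<in> exhausted C"
  by (rule exhausted_subset[OF exhausted_Un[of x y]]) auto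

lemma \<phi>_tail:
  assumes "x \<in> exhausted C" "e > 0" obtains m where "\<phi> (x - {..<m}) < e"
proof -
  obtain n where n: "(1/2::real) ^ n < e" using real_arch_pow_inv[of e "1/2"] assms(2) by auto
  obtain m where "x - {..<m} \<in> C n" using assms(1) unfolding exhausted_def by blast
  then show thesis using \<phi>_le_if_in_C n that by (meson order_le_less_trans)
qed

section \<open>The Polish group of exhausted sets under symmetric difference\<close>

definition sdist :: "nat set \<Rightarrow> nat set \<Rightarrow> real" where
  "sdist x y = \<phi> (sym_diff x y)"

sublocale Metric_space "exhausted C" sdist
proof
  show "sdist x y = sdist y x" for x y by (simp add: sdist_def Un_commute)
  show "sdist x z \<le> sdist x y + sdist y z" for x y z
  proof -
    have "sdist x z \<le> \<phi> (sym_diff x y \<union> sym_diff y z)"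
      unfolding sdist_def by (rule \<phi>_mono) auto
    also have "\<dots> \<le> sdist x y + sdist y z" unfolding sdist_def by (rule \<phi>_Un_le)
    finally show ?thesis .
  qed
qed (auto simp: sdist_def \<phi>_nonneg \<phi>_eq_0_iff)

text \<open>The finite sets are dense: a set differs from its initial segment by a tail, and tails
  are small.\<close>

lemma separable: "separable_space mtopology"
proof -
  have "mtopology closure_of {x. finite x} = exhausted C"
    unfolding metric_closure_of
  proof (intro subset_antisym subsetI CollectI conjI allI impI)
    fix x and r :: real assume x: "x \<in> exhausted C" and r: "r > 0"
    obtain m where m: "\<phi> (x - {..<m}) < r" using \<phi>_tail[OF x r] .
    have "sym_diff x (x \<inter> {..<m}) = x - {..<m}" by auto
    then have "x \<inter> {..<m} \<in> mball x r"
      using x m finite_exhausted[of "x \<inter> {..<m}"] by (simp add: sdist_def)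
    then show "\<exists>y\<in>{x. finite x}. y \<in> mball x r" by blast
  qed auto
  then show ?thesis
    unfolding separable_space_def using finite_exhausted countable_Collect_finite
    by (intro exI[of _ "{x. finite x}"]) (simp add: subset_iff)
qed

text \<open>Members of \<open>C (Suc k)\<close> omit \<open>k\<close>, so a Cauchy sequence is
  eventually constant at each integer. Finite character carries the Cauchy estimates over to the
  pointwise limit \<open>x\<close>.\<close>

lemma complete: mcomplete
  unfolding mcomplete_def
proof (intro allI impI)
  fix \<sigma> assume \<sigma>: "MCauchy \<sigma>"
  have "\<exists>N. \<forall>i j. N \<le> i \<longrightarrow> N \<le> j \<longrightarrow> sym_diff (\<sigma> i) (\<sigma> j) \<in> C n" for n
  proof -
    have "(0::real) < (1/2) ^ n" by simp
    then obtain N where "\<forall>i j. N \<le> i \<longrightarrow> N \<le> j \<longrightarrow> sdist (\<sigma> i) (\<sigma> j) < (1/2) ^ n"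
      using \<sigma> unfolding MCauchy_def by blast
    then show ?thesis using in_C_if_\<phi>_less unfolding sdist_def by blast
  qed
  then obtain N where N: "\<And>n i j. N n \<le> i \<Longrightarrow> N n \<le> j \<Longrightarrow> sym_diff (\<sigma> i) (\<sigma> j) \<in> C n"
    by metis
  define x where "x = {k. k \<in> \<sigma> (N (Suc k))}"
  have x: "k \<in> x \<longleftrightarrow> k \<in> \<sigma> j" if "N (Suc k) \<le> j" for k j
    using C_Suc[OF N[OF order_refl that]] by (auto simp: x_def)
  have close: "sym_diff (\<sigma> i) x \<in> C n" if i: "N n \<le> i" for n i
  proof (rule finite_character_closed[OF fin_char])
    fix F assume F: "finite F" "F \<subseteq> sym_diff (\<sigma> i) x"
    \<comment> \<open>From \<open>j\<close> on the sequence agrees with \<open>x\<close> on the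
      finite set \<open>F\<close> and is within the Cauchy range for \<open>n\<close>.\<close>
    define j where "j = Max (insert (N n) ((\<lambda>k. N (Suc k)) ` F))"
    have j: "N n \<le> j" "\<And>k. k \<in> F \<Longrightarrow> N (Suc k) \<le> j"
      unfolding j_def using F(1) by (auto intro: Max_ge)
    have "F \<subseteq> sym_diff (\<sigma> i) (\<sigma> j)" using F(2) x j(2) by blast
    then show "F \<in> C n" using C_subset N[OF i j(1)] by blast
  qed
  have "x \<in> exhausted C"
    unfolding exhausted_def
  proof safe
    fix n
    let ?y = "\<sigma> (N (Suc n))"
    have "?y \<in> exhausted C" using \<sigma> by (auto simp: MCauchy_def)
    then obtain m where m: "?y - {..<m} \<in> C (Suc n)" unfolding exhausted_def by blast
    have "sym_diff ?y x \<union> (?y - {..<m}) \<union> {} \<in> C n"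
      by (intro Un3 close m empty_in_C) simp
    then have "x - {..<m} \<in> C n" by (rule C_subset) auto
    then show "\<exists>m. x - {..<m} \<in> C n" ..
  qed
  moreover have "\<exists>N. \<forall>i\<ge>N. \<sigma> i \<in> exhausted C \<and> sdist (\<sigma> i) x < e" if e: "e > 0" for e
  proof -
    obtain n where n: "(1/2::real) ^ n < e" using real_arch_pow_inv[of e "1/2"] e by auto
    have "sdist (\<sigma> i) x < e" if "N n \<le> i" for i
      using \<phi>_le_if_in_C[OF close[OF that]] n unfolding sdist_def by simp
    moreover have "range \<sigma> \<subseteq> exhausted C" using \<sigma> by (simp add: MCauchy_def)
    ultimately show ?thesis by (intro exI[of _ "N n"]) auto
  qed
  ultimately show "\<exists>x. limitin mtopology \<sigma> x sequentially"
    unfolding limit_metric_sequentially by blast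
qed

definition G :: "nat set monoid" where
  "G = \<lparr>carrier = exhausted C, mult = sym_diff, one = {}\<rparr>"

lemma G_simps [simp]: "carrier G = exhausted C" "x \<otimes>\<^bsub>G\<^esub> y = sym_diff x y" "\<one>\<^bsub>G\<^esub> = {}"
  by (simp_all add: G_def)

lemma comm_group_G: "comm_group G"
proof (rule comm_groupI)
  fix x y z assume "x \<in> carrier G" "y \<in> carrier G" "z \<in> carrier G"
  show "x \<otimes>\<^bsub>G\<^esub> y \<otimes>\<^bsub>G\<^esub> z = x \<otimes>\<^bsub>G\<^esub> (y \<otimes>\<^bsub>G\<^esub> z)" by auto
next
  fix x assume "x \<in> carrier G"
  then show "\<exists>y\<in>carrier G. y \<otimes>\<^bsub>G\<^esub> x = \<one>\<^bsub>G\<^esub>" by (intro bexI[of _ x]) auto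
qed (auto simp: exhausted_sym_diff finite_exhausted)

lemma inv_G:
  assumes "x \<in> exhausted C" shows "inv\<^bsub>G\<^esub> x = x"
proof -
  interpret comm_group G by (rule comm_group_G)
  show ?thesis by (rule inv_equality) (use assms in auto)
qed

lemma polish_abelian_group_G: "polish_abelian_group G mtopology"
proof -
  interpret G: comm_group G by (rule comm_group_G)
  show ?thesis
  proof
    show "topspace mtopology = carrier G" by simp
    show "Hausdorff_space mtopology" by (rule Hausdorff_space_mtopology)
    show "continuous_map mtopology mtopology (\<lambda>x. inv\<^bsub>G\<^esub> x)"
      by (rule continuous_map_eq[OF continuous_map_id]) (simp add: inv_G)
    show "polish_topology mtopology"
      unfolding polish_topology_def using complete separable completely_metrizable_space_mtopology by blast
    show "continuous_map (prod_topology mtopology mtopology) mtopology (\<lambda>(x, y). x \<otimes>\<^bsub>G\<^esub> y)"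
      unfolding continuous_map_to_metric
    proof (intro ballI allI impI)
      fix p and e :: real assume p: "p \<in> topspace (prod_topology mtopology mtopology)" and e: "e > 0"
      obtain x y where xy: "p = (x, y)" "x \<in> exhausted C" "y \<in> exhausted C" using p by auto
      show "\<exists>U. openin (prod_topology mtopology mtopology) U \<and> p \<in> U \<and>
          (\<forall>q\<in>U. (case q of (x, y) \<Rightarrow> x \<otimes>\<^bsub>G\<^esub> y) \<in> mball (case p of (x, y) \<Rightarrow> x \<otimes>\<^bsub>G\<^esub> y) e)"
      proof (intro exI[of _ "mball x (e/2) \<times> mball y (e/2)"] conjI ballI)
        fix q assume "q \<in> mball x (e/2) \<times> mball y (e/2)"
        then obtain x' y' where q: "q = (x', y')" "x' \<in> mball x (e/2)" "y' \<in> mball y (e/2)" by blast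
        have "sdist (sym_diff x y) (sym_diff x' y') \<le> \<phi> (sym_diff x x' \<union> sym_diff y y')"
          unfolding sdist_def by (rule \<phi>_mono) auto
        also have "\<dots> \<le> sdist x x' + sdist y y'" unfolding sdist_def by (rule \<phi>_Un_le)
        also have "\<dots> < e" using q by simp
        finally show "(case q of (x, y) \<Rightarrow> x \<otimes>\<^bsub>G\<^esub> y) \<in> mball (case p of (x, y) \<Rightarrow> x \<otimes>\<^bsub>G\<^esub> y) e"
          using q xy by (simp add: exhausted_sym_diff)
      qed (use xy e in \<open>auto simp: openin_prod_Times_iff\<close>)
    qed
  qed
qed

lemma finprod_singletons: "finite F \<Longrightarrow> finprod G (\<lambda>n. {n}) F = F"
proof (induction F rule: finite_induct)
  case empty
  interpret comm_group G by (rule comm_group_G)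
  show ?case by simp
next
  case (insert a F)
  interpret comm_group G by (rule comm_group_G)
  have "finprod G (\<lambda>n. {n}) (insert a F) = {a} \<otimes>\<^bsub>G\<^esub> finprod G (\<lambda>n. {n}) F"
    by (rule finprod_insert) (use insert in \<open>auto simp: finite_exhausted\<close>)
  then show ?case using insert by auto
qed

text \<open>The product of the singletons over a finite \<open>F\<close> is \<open>F\<close> itself.
  Hence the only possible limit is \<open>A\<close>, which is reached exactly when \<open>A\<close>
  belongs to the group.\<close>

lemma sum_converges_singletons_iff: "sum_converges G mtopology (\<lambda>n. {n}) A \<longleftrightarrow> A \<in> exhausted C"
proof
  assume "A \<in> exhausted C"
  have "sum_converges_to G mtopology (\<lambda>n. {n}) A A"
    unfolding sum_converges_to_def limitin_metric
  proof (intro conjI allI impI)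
    fix e :: real assume "e > 0"
    then obtain m where m: "\<phi> (A - {..<m}) < e" using \<phi>_tail \<open>A \<in> exhausted C\<close> by blast
    show "\<forall>\<^sub>F F in finite_subsets_at_top A. finprod G (\<lambda>n. {n}) F \<in> exhausted C
        \<and> sdist (finprod G (\<lambda>n. {n}) F) A < e"
      unfolding eventually_finite_subsets_at_top
    proof (intro exI[of _ "A \<inter> {..<m}"] conjI allI impI; (elim conjE)?)
      fix F assume F: "finite F" "A \<inter> {..<m} \<subseteq> F" "F \<subseteq> A"
      have "sdist F A \<le> \<phi> (A - {..<m})" unfolding sdist_def by (rule \<phi>_mono) (use F in auto)
      then show "sdist (finprod G (\<lambda>n. {n}) F) A < e" using m F by (simp add: finprod_singletons)
    qed (auto simp: finprod_singletons finite_exhausted)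
  qed fact
  then show "sum_converges G mtopology (\<lambda>n. {n}) A"
    unfolding sum_converges_def using \<open>A \<in> exhausted C\<close> by auto
next
  assume "sum_converges G mtopology (\<lambda>n. {n}) A"
  then obtain a where a: "a \<in> exhausted C" "limitin mtopology (finprod G (\<lambda>n. {n})) a (finite_subsets_at_top A)"
    unfolding sum_converges_def sum_converges_to_def by auto
  have "k \<in> a \<longleftrightarrow> k \<in> A" for k
  proof -
    have "(0::real) < (1/2) ^ Suc k" by simp
    then obtain X where X: "finite X" "X \<subseteq> A"
      "\<And>F. finite F \<Longrightarrow> X \<subseteq> F \<Longrightarrow> F \<subseteq> A \<Longrightarrow> sdist (finprod G (\<lambda>n. {n}) F) a < (1/2) ^ Suc k"
      using a(2) unfolding limitin_metric eventually_finite_subsets_at_top by meson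
    \<comment> \<open>This set agrees with \<open>A\<close> at \<open>k\<close>, and its closeness
      to \<open>a\<close> forces agreement with \<open>a\<close> at \<open>k\<close>.\<close>
    let ?F = "X \<union> (A \<inter> {k})"
    have "sdist ?F a < (1/2) ^ Suc k" using X(3)[of ?F] X(1,2) by (simp add: finprod_singletons)
    then have "sym_diff ?F a \<in> C (Suc k)" unfolding sdist_def by (rule in_C_if_\<phi>_less)
    then have "k \<notin> sym_diff ?F a" by (rule C_Suc)
    then show ?thesis using X(2) by blast
  qed
  then show "A \<in> exhausted C" using a(1) by (metis subsetI subset_antisym)
qed

lemma representable_in_G:
  assumes "ideal_on_omega (exhausted C)"
  shows "representable_in (exhausted C) G mtopology"
  unfolding representable_in_def
proof (intro exI[of _ "\<lambda>n. {n}"] conjI)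
  have "{A. finite A \<or> sum_converges G mtopology (\<lambda>n. {n}) A} = exhausted C"
    using finite_exhausted by (auto simp: sum_converges_singletons_iff)
  then show "exhausted C = summable_ideal G mtopology (\<lambda>n. {n})"
    unfolding summable_ideal_def using assms by (simp add: hull_same)
  show "\<not> sum_converges G mtopology (\<lambda>n. {n}) UNIV"
    using assms unfolding sum_converges_singletons_iff ideal_on_omega_def by blast
qed (auto simp: finite_exhausted)

end

text \<open>Existence is witnessed by a group whose elements are sets of natural numbers, so the
  equivalence is stated over \<open>nat set\<close>; the second conjunct extends the implication
  from representability to groups over an arbitrary type.\<close>

theorem theorem5p1:
  fixes J :: "nat set set"
  assumes "ideal_on_omega J"
  shows "((\<exists>(G :: nat set monoid) T. polish_abelian_group G T \<and> representable_in J G T)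
            \<longleftrightarrow> analytic_family J \<and> P_ideal J)
       \<and> (\<forall>(G :: 'a monoid) T. polish_abelian_group G T \<and> representable_in J G T
            \<longrightarrow> analytic_family J \<and> P_ideal J)"
proof (intro conjI iffI)
  assume "\<exists>(G :: nat set monoid) T. polish_abelian_group G T \<and> representable_in J G T"
  then show "analytic_family J" "P_ideal J"
    using representable_imp_analytic_P_ideal by blast+
next
  assume "analytic_family J \<and> P_ideal J"
  then obtain C where C: "exhausting_sequence C" "J = exhausted C"
    using analytic_P_ideal_exhausting assms by blast
  interpret exhausting_sequence C by fact
  show "\<exists>(G :: nat set monoid) T. polish_abelian_group G T \<and> representable_in J G T"
    using polish_abelian_group_G representable_in_G assms unfolding C(2) by blast
next
  show "\<forall>(G :: 'a monoid) T. polish_abelian_group G T \<and> representable_in J G T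
            \<longrightarrow> analytic_family J \<and> P_ideal J"
    using representable_imp_analytic_P_ideal by blast
qed

end
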